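(* Let $G\subset \mathrm{SO}(4)$ be a discrete (equivalently, finite) subgroup and let $H$ be the normal subgroup of $G$ generated by the stabilizers $G_x$, $x\in S^3$, of the induced action of $G$ on the unit sphere $S^3\subset \mathbb{R}^4$. The following conditions are equivalent: \begin{enumerate} \item $H=G$; \item $\pi_1(S^3/G)=1$; \item $G$ is generated by rotations. \end{enumerate}
   Context: A rotation is an orientation-preserving orthogonal transformation which is the identity on a real codimension 2 subspace. *)

theory Defs
  imports
    "HOL-Analysis.Analysis"
    "HOL-Algebra.Group_Action"
    "HOL-Algebra.Generated_Groups"
    "HOL-Algebra.Elementary_Groups"
begin

section \<open>The special orthogonal group and its action on the unit sphere\<close>

text \<open>In HOL-Analysis a rotation matrix is any orthogonal matrix of determinant 1; the stricter
  notion of a rotation used here is \<open>is_rotation\<close>.\<close>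

definition SO :: "(real^'n^'n) monoid" where
  "SO = \<lparr>carrier = {A. rotation_matrix A}, mult = (**), one = mat 1\<rparr>"

definition is_rotation :: "real^'n^'n \<Rightarrow> bool" where
  "is_rotation A \<longleftrightarrow> rotation_matrix A \<and>
     (\<exists>V. subspace V \<and> dim V + 2 = CARD('n) \<and> (\<forall>v\<in>V. A *v v = v))"

text \<open>Restricted to the sphere, so that it is an action in the sense of the locale
  \<^locale>\<open>group_action\<close>, whose maps are extensional.\<close>

definition sphere_action :: "real^'n^'n \<Rightarrow> real^'n \<Rightarrow> real^'n" where
  "sphere_action A = (\<lambda>v\<in>sphere 0 1. A *v v)"

lemma group_SO: "group (SO :: (real^'n^'n) monoid)"
proof (rule groupI)
  fix A :: "real^'n^'n" assume A: "A \<in> carrier SO"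
  have "transpose A \<in> carrier SO" "transpose A ** A = mat 1"
    using A by (auto simp: SO_def rotation_matrix_def orthogonal_matrix_def)
  then show "\<exists>B\<in>carrier SO. B \<otimes>\<^bsub>SO\<^esub> A = \<one>\<^bsub>SO\<^esub>"
    by (auto simp: SO_def)
qed (auto simp: SO_def rotation_matrix_def orthogonal_matrix_mul orthogonal_matrix_id
      det_mul matrix_mul_assoc)

lemma sphere_action_Bij:
  assumes "A \<in> carrier (SO :: (real^'n^'n) monoid)"
  shows "sphere_action A \<in> Bij (sphere 0 1)"
proof -
  have o: "orthogonal_matrix A" using assms by (simp add: SO_def rotation_matrix_def)
  have n: "norm (M *v v) = norm v" if "orthogonal_matrix M" for M :: "real^'n^'n" and v
    using that orthogonal_transformation_matrix[of "(*v) M"]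
    by (intro orthogonal_transformation_norm) simp
  have t: "orthogonal_matrix (transpose A)"
    using o by (simp only: orthogonal_matrix_transpose)
  have "bij_betw ((*v) A) (sphere 0 1) (sphere 0 1)"
  proof (rule bij_betw_byWitness[where f' = "(*v) (transpose A)"])
    show "(*v) A ` sphere 0 1 \<subseteq> sphere 0 1"
      using n[OF o] by auto
    show "(*v) (transpose A) ` sphere 0 1 \<subseteq> sphere 0 1"
      using n[OF t] by (auto simp del: transpose_matrix_vector)
  qed (use o in \<open>auto simp: orthogonal_matrix_def matrix_vector_mul_assoc
        simp del: transpose_matrix_vector\<close>)
  then have "bij_betw (sphere_action A) (sphere 0 1) (sphere 0 1)"
    by (subst bij_betw_cong[where g = "(*v) A"]) (auto simp: sphere_action_def)
  moreover have "sphere_action A \<in> extensional (sphere 0 1)"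
    by (simp add: sphere_action_def)
  ultimately show ?thesis
    by (simp add: Bij_def)
qed

lemma group_action_sphere:
  fixes G :: "(real^'n^'n) set"
  assumes "subgroup G SO"
  shows "group_action (SO\<lparr>carrier := G\<rparr>) (sphere 0 1) sphere_action"
proof -
  have sub: "G \<subseteq> carrier SO" using assms by (rule subgroup.subset)
  have "sphere_action (A ** B) = compose (sphere 0 1) (sphere_action A) (sphere_action B)"
    if "A \<in> G" "B \<in> G" for A B
  proof -
    have "sphere_action B v \<in> sphere 0 1" if "v \<in> sphere 0 1" for v
      using sphere_action_Bij[of B] sub \<open>B \<in> G\<close> that bij_betwE
      unfolding Bij_def by blast
    then have "B *v v \<in> sphere 0 1" if "v \<in> sphere 0 1" for v
      using that by (metis restrict_apply' sphere_action_def)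
    then show ?thesis
      unfolding sphere_action_def compose_def
      by (intro restrict_ext) (simp add: matrix_vector_mul_assoc)
  qed
  then have "sphere_action \<in> hom (SO\<lparr>carrier := G\<rparr>) (BijGroup (sphere 0 1))"
    using sphere_action_Bij sub by (auto simp: hom_def BijGroup_def SO_def)
  then show ?thesis
    using group.subgroup_imp_group[OF group_SO assms] group_BijGroup
    by (auto simp: group_action_def group_hom_def group_hom_axioms_def)
qed


section \<open>Normal subgroups generated by a set\<close>

definition normal_closure :: "('a, 'b) monoid_scheme \<Rightarrow> 'a set \<Rightarrow> 'a set" where
  "normal_closure G S = \<Inter>{N. N \<lhd> G \<and> S \<subseteq> N}"

text \<open>For a conjugation-invariant set, such as the union of all stabilizers of an action, the
  subgroup generated by the set is already normal.\<close>

lemma (in group) normal_closure_eq_generate: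
  assumes "S \<subseteq> carrier G"
    and "\<And>g s. g \<in> carrier G \<Longrightarrow> s \<in> S \<Longrightarrow> g \<otimes> s \<otimes> inv g \<in> S"
  shows "normal_closure G S = generate G S"
proof
  have "generate G S \<lhd> G" using assms by (intro normal_generateI) auto
  then show "normal_closure G S \<subseteq> generate G S"
    by (auto simp: normal_closure_def intro: generate.incl)
  show "generate G S \<subseteq> normal_closure G S"
    unfolding normal_closure_def
    using generate_subgroup_incl normal_imp_subgroup by (intro Inter_greatest) blast
qed


section \<open>Orbit spaces\<close>

definition orbit_space ::
  "('a, 'c) monoid_scheme \<Rightarrow> 'b topology \<Rightarrow> ('a \<Rightarrow> 'b \<Rightarrow> 'b) \<Rightarrow> 'b set topology" where
  "orbit_space G X \<phi> = topology (\<lambda>U. U \<subseteq> orbits G (topspace X) \<phi> \<and>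
     openin X {x \<in> topspace X. orbit G \<phi> x \<in> U})"

lemma openin_orbit_space:
  "openin (orbit_space G X \<phi>) U \<longleftrightarrow>
     U \<subseteq> orbits G (topspace X) \<phi> \<and> openin X {x \<in> topspace X. orbit G \<phi> x \<in> U}"
proof -
  have "istopology (\<lambda>U. U \<subseteq> orbits G (topspace X) \<phi> \<and>
     openin X {x \<in> topspace X. orbit G \<phi> x \<in> U})"
    unfolding istopology_def
  proof (intro conjI allI impI; (elim conjE)?)
    fix S T assume "openin X {x \<in> topspace X. orbit G \<phi> x \<in> S}"
      "openin X {x \<in> topspace X. orbit G \<phi> x \<in> T}"
    then have "openin X ({x \<in> topspace X. orbit G \<phi> x \<in> S} \<inter> {x \<in> topspace X. orbit G \<phi> x \<in> T})"
      by blast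
    then show "openin X {x \<in> topspace X. orbit G \<phi> x \<in> S \<inter> T}"
      by (rule back_subst[of "openin X"]) auto
  next
    fix \<K> assume "\<forall>K\<in>\<K>. K \<subseteq> orbits G (topspace X) \<phi> \<and> openin X {x \<in> topspace X. orbit G \<phi> x \<in> K}"
    then have "openin X (\<Union>K\<in>\<K>. {x \<in> topspace X. orbit G \<phi> x \<in> K})"
      by blast
    then show "openin X {x \<in> topspace X. orbit G \<phi> x \<in> \<Union>\<K>}"
      by (rule back_subst[of "openin X"]) auto
  qed blast+
  then show ?thesis
    by (simp add: orbit_space_def)
qed

lemma topspace_orbit_space: "topspace (orbit_space G X \<phi>) = orbits G (topspace X) \<phi>"
proof -
  have "{x \<in> topspace X. orbit G \<phi> x \<in> orbits G (topspace X) \<phi>} = topspace X"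
    by (auto simp: orbits_def)
  then have "openin (orbit_space G X \<phi>) (orbits G (topspace X) \<phi>)"
    by (simp add: openin_orbit_space)
  then show ?thesis
    by (meson openin_orbit_space openin_subset openin_topspace subset_antisym)
qed

lemma quotient_map_orbit: "quotient_map X (orbit_space G X \<phi>) (orbit G \<phi>)"
  by (auto simp: quotient_map_def openin_orbit_space topspace_orbit_space orbits_def)


section \<open>The fundamental group of a topological space\<close>

text \<open>The library develops homotopies of paths only for subsets of a type of class
  \<^class>\<open>topological_space\<close>; a loop in an abstract topology is a path \<^term>\<open>f\<close>
  with \<^term>\<open>pathin X f\<close>, parametrized by the unit interval. Values of \<^term>\<open>f\<close> outside
  the unit interval are irrelevant, and homotopic loops may differ there.\<close>

definition loops_at :: "'a topology \<Rightarrow> 'a \<Rightarrow> (real \<Rightarrow> 'a) set" where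
  "loops_at X p = {f. pathin X f \<and> f 0 = p \<and> f 1 = p}"

definition loop_homotopic :: "'a topology \<Rightarrow> 'a \<Rightarrow> (real \<Rightarrow> 'a) \<Rightarrow> (real \<Rightarrow> 'a) \<Rightarrow> bool" where
  "loop_homotopic X p = homotopic_with (\<lambda>h. h 0 = p \<and> h 1 = p) (top_of_set {0..1}) X"

definition loop_concat :: "(real \<Rightarrow> 'a) \<Rightarrow> (real \<Rightarrow> 'a) \<Rightarrow> real \<Rightarrow> 'a" where
  "loop_concat f g = (\<lambda>t. if t \<le> 1/2 then f (2 * t) else g (2 * t - 1))"

definition loop_class :: "'a topology \<Rightarrow> 'a \<Rightarrow> (real \<Rightarrow> 'a) \<Rightarrow> (real \<Rightarrow> 'a) set" where
  "loop_class X p f = {g. loop_homotopic X p f g}"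

definition fundamental_group :: "'a topology \<Rightarrow> 'a \<Rightarrow> (real \<Rightarrow> 'a) set monoid" where
  "fundamental_group X p =
     \<lparr>carrier = loop_class X p ` loops_at X p,
      mult = (\<lambda>a b. \<Union>f\<in>a. \<Union>g\<in>b. loop_class X p (loop_concat f g)),
      one = loop_class X p (\<lambda>_. p)\<rparr>"

lemma loop_homotopic_refl: "f \<in> loops_at X p \<Longrightarrow> loop_homotopic X p f f"
  by (auto simp: loops_at_def loop_homotopic_def pathin_def)

lemma loop_homotopic_sym: "loop_homotopic X p f g \<Longrightarrow> loop_homotopic X p g f"
  unfolding loop_homotopic_def by (rule homotopic_with_symD)

lemma loop_homotopic_trans:
  "loop_homotopic X p f g \<Longrightarrow> loop_homotopic X p g h \<Longrightarrow> loop_homotopic X p f h"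
  unfolding loop_homotopic_def by (rule homotopic_with_trans)

lemma loop_homotopic_imp_loops:
  "loop_homotopic X p f g \<Longrightarrow> f \<in> loops_at X p \<and> g \<in> loops_at X p"
  unfolding loop_homotopic_def loops_at_def pathin_def
  by (frule homotopic_with_imp_property, drule homotopic_with_imp_continuous_maps) blast

lemma loop_concat_in_loops:
  assumes "f \<in> loops_at X p" "g \<in> loops_at X p"
  shows "loop_concat f g \<in> loops_at X p"
proof -
  have "continuous_map (top_of_set {0..1::real}) X
     (\<lambda>t. if t \<le> 1/2 then (f \<circ> (\<lambda>t. 2 * t)) t else (g \<circ> (\<lambda>t. 2 * t - 1)) t)"
  proof (rule continuous_map_cases_le)
    show "continuous_map (subtopology (top_of_set {0..1}) {t \<in> topspace (top_of_set {0..1}). t \<le> 1/2}) X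
            (f \<circ> (\<lambda>t. 2 * t))"
      by (rule continuous_map_compose[of _ "top_of_set {0..1}"])
        (use assms in \<open>auto simp: subtopology_subtopology loops_at_def pathin_def intro!: continuous_intros\<close>)
    show "continuous_map (subtopology (top_of_set {0..1}) {t \<in> topspace (top_of_set {0..1}). 1/2 \<le> t}) X
            (g \<circ> (\<lambda>t. 2 * t - 1))"
      by (rule continuous_map_compose[of _ "top_of_set {0..1}"])
        (use assms in \<open>auto simp: subtopology_subtopology loops_at_def pathin_def intro!: continuous_intros\<close>)
    show "(f \<circ> (\<lambda>t. 2 * t)) t = (g \<circ> (\<lambda>t. 2 * t - 1)) t"
      if "t \<in> topspace (top_of_set {0..1})" "t = 1/2" for t
    proof -
      have "2 * t = 1" using that by simp
      then show ?thesis using assms by (simp add: loops_at_def)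
    qed
  qed auto
  then have "pathin X (loop_concat f g)"
    by (simp only: pathin_def loop_concat_def o_def)
  then show ?thesis
    using assms by (simp add: loops_at_def loop_concat_def)
qed

lemma loop_class_eq_iff:
  assumes "f \<in> loops_at X p" "g \<in> loops_at X p"
  shows "loop_class X p f = loop_class X p g \<longleftrightarrow> loop_homotopic X p f g"
  using assms unfolding loop_class_def
  by (metis (mono_tags, lifting) Collect_cong loop_homotopic_refl loop_homotopic_sym
      loop_homotopic_trans mem_Collect_eq)

lemma trivial_fundamental_group_iff:
  assumes "p \<in> topspace X"
  shows "trivial_group (fundamental_group X p) \<longleftrightarrow>
    (\<forall>f\<in>loops_at X p. loop_homotopic X p f (\<lambda>_. p))"
proof -
  let ?c = "\<lambda>_::real. p"
  have c: "?c \<in> loops_at X p"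
    using assms by (auto simp: loops_at_def pathin_def)
  have iff: "carrier (fundamental_group X p) = {\<one>\<^bsub>fundamental_group X p\<^esub>} \<longleftrightarrow>
    (\<forall>f\<in>loops_at X p. loop_homotopic X p f ?c)"
    (is "?L \<longleftrightarrow> ?R")
  proof -
    have "?L \<longleftrightarrow> (\<forall>f\<in>loops_at X p. loop_class X p f = loop_class X p ?c)"
    proof -
      have "h ` loops_at X p = {h ?c} \<longleftrightarrow> (\<forall>f\<in>loops_at X p. h f = h ?c)"
        for h :: "(real \<Rightarrow> 'a) \<Rightarrow> (real \<Rightarrow> 'a) set"
        using c by auto
      then show ?thesis
        by (simp add: fundamental_group_def)
    qed
    also have "\<dots> \<longleftrightarrow> ?R"
      using c by (simp add: loop_class_eq_iff)
    finally show ?thesis .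
  qed
  have "group (fundamental_group X p)"
    if *: "\<forall>f\<in>loops_at X p. loop_homotopic X p f ?c"
  proof -
    have eq: "loop_class X p f = loop_class X p ?c" if "f \<in> loops_at X p" for f
      using * c that by (simp add: loop_class_eq_iff)
    have in_loops: "f \<in> loops_at X p" if "f \<in> loop_class X p ?c" for f
      using that loop_homotopic_imp_loops[of X p ?c f] by (simp add: loop_class_def)
    have ne: "loop_class X p ?c \<noteq> {}"
      using loop_homotopic_refl[OF c] by (auto simp: loop_class_def)
    have "(\<Union>f\<in>loop_class X p ?c. \<Union>g\<in>loop_class X p ?c. loop_class X p (loop_concat f g))
      = (\<Union>f\<in>loop_class X p ?c. \<Union>g\<in>loop_class X p ?c. loop_class X p ?c)"
      by (intro SUP_cong refl eq loop_concat_in_loops in_loops)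
    also have "\<dots> = loop_class X p ?c"
      using ne by auto
    finally have m: "\<one>\<^bsub>fundamental_group X p\<^esub> \<otimes>\<^bsub>fundamental_group X p\<^esub> \<one>\<^bsub>fundamental_group X p\<^esub>
      = \<one>\<^bsub>fundamental_group X p\<^esub>"
      by (simp add: fundamental_group_def)
    have "carrier (fundamental_group X p) = {\<one>\<^bsub>fundamental_group X p\<^esub>}"
      using iff * by blast
    then show ?thesis
      using m by (intro groupI) auto
  qed
  then show ?thesis
    unfolding trivial_group_def using iff by blast
qed

end

theory Submission
  imports Defs
begin

text \<open>
  The statement combines Armstrong's theorem on fundamental groups of orbit spaces with a fact
  about \<open>SO(4)\<close>. Discreteness and compactness make \<open>G\<close> finite. An element of \<open>SO(4)\<close> that fixes
  a unit vector fixes a second one orthogonal to it, so the elements of the stabilizers are exactly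
  the rotations in \<open>G\<close> (\<open>is_rotation_iff_fixed_point\<close>). They form a conjugation-invariant set, and
  hence \<open>H\<close> is the subgroup that the rotations generate. This gives the equivalence of the first and
  third conditions, and what is left is that the orbit space is simply connected iff the elements
  with fixed points generate \<open>G\<close>. That holds on every sphere of dimension at least two
  (\<open>simply_connected_orbit_space_iff\<close>).

  Suppose first that the orbit space is simply connected, and let \<open>N\<close> be a subgroup that contains
  every element with a fixed point. Then the map from the orbit space of \<open>N\<close> to that of
  \<open>G\<close> is a covering (\<open>covering_space_proj\<close>). A path in the sphere from \<open>x\<close> to \<open>A x\<close> with \<open>A\<close> in \<open>G\<close>
  projects to a loop below; this loop is null-homotopic, so its lift to the orbit space of \<open>N\<close> is a
  loop as well. Thus \<open>A x = B x\<close> for some \<open>B\<close> in \<open>N\<close>, and as \<open>B\<^sup>-\<^sup>1A\<close> fixes \<open>x\<close>, the element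
  \<open>A\<close> is in \<open>N\<close>.

  Suppose conversely that the elements with fixed points generate \<open>G\<close>. A small ball about \<open>x\<close> meets
  only those of its translates that come from elements fixing \<open>x\<close>, and its contraction to \<open>x\<close>
  along great circles commutes with these elements. So the image of the ball is contractible,
  and every path in the orbit space is homotopic to the projection of a path in the sphere
  (\<open>homotopic_to_projected_path\<close>). A loop therefore comes from a path from some \<open>a\<close> to \<open>A a\<close>. The
  elements \<open>A\<close> for which all such paths project to null-homotopic loops form a subgroup. It contains
  each \<open>A\<close> with a fixed point \<open>x\<close>: a path from \<open>a\<close> to \<open>x\<close> followed by the \<open>A\<close>-translate of its reverse
  projects to a path followed by its own reverse.

  Orbits are encoded by their truncated distance functions. This realizes the orbit space inside a
  normed space, where homotopies of paths and coverings are at hand.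
\<close>

section \<open>Orthogonal matrices and simply connected sets\<close>

text \<open>Rewriting \<open>transpose A *v x\<close> to \<open>x v* A\<close> would hide the cancellation with \<open>A\<close>.\<close>

declare transpose_matrix_vector [simp del]

lemma orthogonal_matrix_isometry:
  fixes A :: "real^'n^'n"
  assumes "orthogonal_matrix A"
  shows "norm (A *v x) = norm x" "dist (A *v x) (A *v y) = dist x y"
proof -
  have "orthogonal_transformation ((*v) A)"
    using assms by (simp add: orthogonal_transformation_matrix)
  then show *: "norm (A *v x) = norm x" for x
    by (rule orthogonal_transformation_norm)
  show "dist (A *v x) (A *v y) = dist x y"
    by (simp add: dist_norm * flip: matrix_vector_mult_diff_distrib)
qed

lemma orthogonal_matrix_transpose_cancel:
  fixes A :: "real^'n^'n"
  assumes "orthogonal_matrix A"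
  shows "transpose A *v (A *v x) = x" "A *v (transpose A *v x) = x"
  using assms by (auto simp: orthogonal_matrix_def matrix_vector_mul_assoc)

lemma simply_connected_imp_contractible_loop:
  fixes T :: "'a::real_normed_vector set"
  assumes "simply_connected T" "path p" "path_image p \<subseteq> T" "pathstart p = a" "pathfinish p = a"
  shows "homotopic_paths T p (linepath a a)"
  using assms by (auto simp: simply_connected_eq_contractible_path)

section \<open>Sets encoded by their distance functions\<close>

text \<open>Bounded continuous functions form a normed space. The truncation provides the bound, and it
  keeps the zero set, by which a closed set is determined.\<close>

definition truncated_infdist :: "'a::metric_space set \<Rightarrow> 'a \<Rightarrow>\<^sub>C real" where
  "truncated_infdist S = Bcontfun (\<lambda>v. min 1 (infdist v S))"

lemma apply_truncated_infdist: "apply_bcontfun (truncated_infdist S) v = min 1 (infdist v S)"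
proof -
  have "(\<lambda>v. min 1 (infdist v S)) \<in> bcontfun"
    by (rule bcontfun_normI[where b = 1])
       (auto intro!: continuous_intros simp: infdist_nonneg)
  then show ?thesis
    by (simp add: truncated_infdist_def Bcontfun_inverse)
qed

lemma truncated_infdist_inject:
  assumes "closed S" "S \<noteq> {}" "closed T" "T \<noteq> {}"
    and "truncated_infdist S = truncated_infdist T"
  shows "S = T"
proof -
  have "min 1 (infdist v S) = min 1 (infdist v T)" for v
    using assms(5) by (metis apply_truncated_infdist)
  moreover have "infdist v X = 0 \<longleftrightarrow> min 1 (infdist v X) = 0" for v and X :: "'a set"
    by (auto simp: min_def)
  ultimately have "infdist v S = 0 \<longleftrightarrow> infdist v T = 0" for v
    by metis
  then show ?thesis
    using assms in_closed_iff_infdist_zero by blast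
qed

lemma infdist_le_add:
  assumes "S \<noteq> {}" "\<And>s. s \<in> S \<Longrightarrow> \<exists>t\<in>T. dist s t \<le> d"
  shows "infdist v T \<le> infdist v S + d"
proof -
  have "infdist v T - d \<le> dist v s" if s: "s \<in> S" for s
  proof -
    obtain t where "t \<in> T" "dist s t \<le> d" using assms(2)[OF s] by blast
    then show ?thesis
      using infdist_le[of t T v] dist_triangle[of v t s] by linarith
  qed
  then have "infdist v T - d \<le> (INF s\<in>S. dist v s)"
    using assms(1) by (intro cINF_greatest) auto
  then show ?thesis using assms(1) by (simp add: infdist_notempty)
qed

text \<open>The encoding does not increase the Hausdorff distance.\<close>

lemma dist_truncated_infdist_le:
  assumes "S \<noteq> {}" "\<And>s. s \<in> S \<Longrightarrow> \<exists>t\<in>T. dist s t \<le> d"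
    and "T \<noteq> {}" "\<And>t. t \<in> T \<Longrightarrow> \<exists>s\<in>S. dist t s \<le> d"
  shows "dist (truncated_infdist S) (truncated_infdist T) \<le> d"
proof (rule dist_bound)
  fix v
  have "infdist v T \<le> infdist v S + d" "infdist v S \<le> infdist v T + d"
    using assms by (auto intro: infdist_le_add)
  then show "dist (apply_bcontfun (truncated_infdist S) v) (apply_bcontfun (truncated_infdist T) v) \<le> d"
    by (auto simp: apply_truncated_infdist dist_real_def)
qed

section \<open>The orbit space of a finite orthogonal group\<close>

definition cap :: "real^'n \<Rightarrow> real \<Rightarrow> (real^'n) set" where
  "cap x r = sphere 0 1 \<inter> ball x r"

text \<open>For \<open>t\<close> from 0 to 1 this moves a unit vector \<open>z\<close> that is not opposite to \<open>x\<close> to \<open>x\<close> along the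
  great circle through both, as the radial projection of a segment.\<close>

definition contract :: "real^'n \<Rightarrow> real \<Rightarrow> real^'n \<Rightarrow> real^'n" where
  "contract x t z = sgn ((1 - t) *\<^sub>R z + t *\<^sub>R x)"

locale finite_orthogonal_group =
  fixes G :: "(real^'n^'n) set"
  assumes finite_G: "finite G"
    and one_closed: "mat 1 \<in> G"
    and mult_closed: "A \<in> G \<Longrightarrow> B \<in> G \<Longrightarrow> A ** B \<in> G"
    and transpose_closed: "A \<in> G \<Longrightarrow> transpose A \<in> G"
    and orthogonal: "A \<in> G \<Longrightarrow> orthogonal_matrix A"
begin

text \<open>The orbit map; its image of the sphere is a copy of the orbit space, see
  \<open>homeomorphic_orbit_space\<close>.\<close>

definition proj :: "real^'n \<Rightarrow> ((real^'n) \<Rightarrow>\<^sub>C real)" where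
  "proj x = truncated_infdist ((\<lambda>A. A *v x) ` G)"

lemma norm_act: "A \<in> G \<Longrightarrow> norm (A *v x) = norm x"
  by (simp add: orthogonal orthogonal_matrix_isometry)

lemma dist_act: "A \<in> G \<Longrightarrow> dist (A *v x) (A *v y) = dist x y"
  by (simp add: orthogonal orthogonal_matrix_isometry)

lemma transpose_act: "A \<in> G \<Longrightarrow> transpose A *v (A *v x) = x"
  "A \<in> G \<Longrightarrow> A *v (transpose A *v x) = x"
  by (simp_all add: orthogonal orthogonal_matrix_transpose_cancel)

lemma orbit_act: 
  assumes "A \<in> G"
  shows "(\<lambda>B. B *v (A *v x)) ` G = (\<lambda>B. B *v x) ` G"
proof safe
  fix B assume B: "B \<in> G"
  show "B *v (A *v x) \<in> (\<lambda>B. B *v x) ` G"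
    using mult_closed[OF B assms] by (auto simp: matrix_vector_mul_assoc)
  have "B *v x = (B ** transpose A) *v (A *v x)"
    using assms by (simp flip: matrix_vector_mul_assoc add: transpose_act)
  then show "B *v x \<in> (\<lambda>B. B *v (A *v x)) ` G"
    using mult_closed[OF B transpose_closed[OF assms]] by blast
qed

lemma proj_act: "A \<in> G \<Longrightarrow> proj (A *v x) = proj x"
  by (simp add: proj_def orbit_act)

lemma proj_eq_iff: "proj x = proj y \<longleftrightarrow> (\<exists>A\<in>G. y = A *v x)"
proof
  assume "proj x = proj y"
  then have "(\<lambda>A. A *v x) ` G = (\<lambda>A. A *v y) ` G"
    unfolding proj_def
    by (intro truncated_infdist_inject) (use finite_G one_closed in \<open>auto intro: finite_imp_closed\<close>)
  moreover have "y \<in> (\<lambda>A. A *v y) ` G"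
    using one_closed by force
  ultimately show "\<exists>A\<in>G. y = A *v x" by blast
qed (auto simp: proj_act)

text \<open>The group acts by isometries, so orbits of nearby points have small Hausdorff distance.\<close>

lemma dist_proj_le: "dist (proj x) (proj y) \<le> dist x y"
  unfolding proj_def
proof (rule dist_truncated_infdist_le)
  show "\<exists>t\<in>(\<lambda>A. A *v y) ` G. dist s t \<le> dist x y" if "s \<in> (\<lambda>A. A *v x) ` G" for s
    using that by (auto simp: dist_act intro!: bexI)
  show "\<exists>t\<in>(\<lambda>A. A *v x) ` G. dist s t \<le> dist x y" if "s \<in> (\<lambda>A. A *v y) ` G" for s
    using that by (auto simp: dist_act dist_commute[of x] intro!: bexI)
qed (use one_closed in auto)

lemma continuous_on_proj: "continuous_on S proj"
  unfolding continuous_on_iff using dist_proj_le by (metis dist_commute le_less_trans)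

abbreviation S :: "(real^'n) set" where "S \<equiv> sphere 0 1"

lemma act_sphere_iff: "A \<in> G \<Longrightarrow> A *v x \<in> S \<longleftrightarrow> x \<in> S"
  by (simp add: norm_act)

text \<open>A continuous map from a compact space to a Hausdorff space is closed.\<close>

lemma quotient_map_proj: "quotient_map (top_of_set S) (top_of_set (proj ` S)) proj"
  by (rule continuous_imp_quotient_map)
     (auto simp: continuous_on_proj Hausdorff_space_subtopology compact_space_subtopology)

text \<open>The preimage of \<open>proj ` U\<close> is the union of the translates of \<open>U\<close>.\<close>

lemma openin_proj_image:
  assumes "openin (top_of_set S) U"
  shows "openin (top_of_set (proj ` S)) (proj ` U)"
proof -
  have US: "U \<subseteq> S" using assms openin_imp_subset by blast
  have "{x \<in> S. proj x \<in> proj ` U} = (\<Union>A\<in>G. S \<inter> (*v) A -` U)"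
  proof (intro equalityI subsetI)
    fix x assume x: "x \<in> {x \<in> S. proj x \<in> proj ` U}"
    then obtain u where "u \<in> U" "proj x = proj u" by blast
    with x show "x \<in> (\<Union>A\<in>G. S \<inter> (*v) A -` U)"
      by (auto simp: proj_eq_iff)
  next
    fix x assume "x \<in> (\<Union>A\<in>G. S \<inter> (*v) A -` U)"
    then obtain A where A: "A \<in> G" "x \<in> S" "A *v x \<in> U" by blast
    have "proj x = proj (A *v x)" using A by (simp add: proj_act)
    then show "x \<in> {x \<in> S. proj x \<in> proj ` U}" using A by blast
  qed
  moreover have "openin (top_of_set S) (S \<inter> (*v) A -` U)" if "A \<in> G" for A
    by (rule continuous_openin_preimage[OF _ _ assms])
       (auto simp: that norm_act intro!: continuous_intros linear_continuous_on)
  ultimately have "openin (top_of_set S) {x \<in> S. proj x \<in> proj ` U}"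
    by (metis (no_types, lifting) openin_Union imageE)
  then show ?thesis
    using quotient_map_proj US unfolding quotient_map_def by (auto simp: image_mono)
qed

section \<open>Slices\<close>

lemma cap_act_iff: "A \<in> G \<Longrightarrow> A *v z \<in> cap (A *v x) r \<longleftrightarrow> z \<in> cap x r"
  by (auto simp: cap_def norm_act dist_act)

lemma openin_cap: "openin (top_of_set S) (cap x r)"
  by (auto simp: cap_def)

text \<open>The finitely many other points of the orbit of \<open>x\<close> keep some distance \<open>d\<close> from \<open>x\<close>, and a cap
  of radius at most \<open>d / 2\<close> is disjoint from the translates that are centred there. The bound
  \<open>r \<le> 1\<close> keeps the cap in an open hemisphere, where \<open>contract\<close> is continuous.\<close>

lemma ex_slice_cap:
  assumes "x \<in> S"
  obtains r where "0 < r" "r \<le> 1" 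
    "\<And>A z. A \<in> G \<Longrightarrow> z \<in> cap x r \<Longrightarrow> A *v z \<in> cap x r \<Longrightarrow> A *v x = x"
proof -
  obtain d where d: "d > 0" "\<And>y. y \<in> (\<lambda>A. A *v x) ` G \<Longrightarrow> y \<noteq> x \<Longrightarrow> d \<le> dist x y"
    using finite_set_avoid[of "(\<lambda>A. A *v x) ` G" x] finite_G by blast
  define r where "r = min 1 (d / 2)"
  have "A *v x = x" if A: "A \<in> G" and z: "z \<in> cap x r" "A *v z \<in> cap x r" for A z
  proof (rule ccontr)
    assume ne: "A *v x \<noteq> x"
    have "d \<le> dist x (A *v x)" using d(2) A ne by blast
    also have "\<dots> \<le> dist x (A *v z) + dist (A *v z) (A *v x)" by (rule dist_triangle)
    also have "\<dots> < r + r" using z A by (auto simp: cap_def dist_act dist_commute)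
    also have "\<dots> \<le> d" by (simp add: r_def)
    finally show False by simp
  qed
  moreover have "0 < r" "r \<le> 1" using d by (auto simp: r_def)
  ultimately show thesis using that by blast
qed

text \<open>Conjugation carries the slice property from \<open>x\<close> to the other points of its orbit.\<close>

lemma slice_cap_act:
  assumes "B \<in> G" 
    and "\<And>A z. A \<in> G \<Longrightarrow> z \<in> cap x r \<Longrightarrow> A *v z \<in> cap x r \<Longrightarrow> A *v x = x"
    and "A \<in> G" "z \<in> cap (B *v x) r" "A *v z \<in> cap (B *v x) r"
  shows "A *v (B *v x) = B *v x"
proof -
  let ?C = "transpose B ** A ** B"
  have C: "?C \<in> G" using assms(1,3) by (intro mult_closed transpose_closed)
  have "transpose B *v z \<in> cap x r" 
    using cap_act_iff[of B "transpose B *v z" x r] assms(1,4) by (simp add: transpose_act)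
  moreover have "?C *v (transpose B *v z) \<in> cap x r"
    using cap_act_iff[of B "transpose B *v (A *v z)" x r] assms(1,5) 
    by (simp add: transpose_act flip: matrix_vector_mul_assoc)
  ultimately have "?C *v x = x" using C by (intro assms(2))
  then have "B *v (transpose B *v (A *v (B *v x))) = B *v x"
    by (simp flip: matrix_vector_mul_assoc)
  then show ?thesis using assms(1) by (simp add: transpose_act)
qed

lemma contract_act:
  assumes "A \<in> G" "A *v x = x"
  shows "contract x t (A *v z) = A *v contract x t z"
proof -
  have "(1 - t) *\<^sub>R (A *v z) + t *\<^sub>R x = A *v ((1 - t) *\<^sub>R z + t *\<^sub>R x)"
    using assms by (simp add: matrix_vector_right_distrib matrix_vector_mult_scaleR)
  then show ?thesis
    using assms(1) by (simp add: contract_def sgn_div_norm norm_act matrix_vector_mult_scaleR)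
qed

text \<open>On the unit sphere \<open>dist x z ^ 2 = 2 - 2 * (z \<bullet> x)\<close>, so caps are cut out by half-spaces. In this
  form it is clear that contraction to the centre does not leave the cap.\<close>

lemma in_cap_iff_inner:
  assumes "x \<in> S"
  shows "z \<in> cap x r \<longleftrightarrow> z \<in> S \<and> 0 < r \<and> 1 - r\<^sup>2 / 2 < z \<bullet> x"
proof (cases "z \<in> S")
  case True
  have "z \<bullet> z = 1" "x \<bullet> x = 1"
    using True assms by (auto simp: norm_eq_1)
  then have "(dist x z)\<^sup>2 = 2 - 2 * (z \<bullet> x)"
    by (simp add: dist_norm power2_norm_eq_inner inner_diff inner_commute)
  moreover have "dist x z < r \<longleftrightarrow> 0 < r \<and> (dist x z)\<^sup>2 < r\<^sup>2"
    by (smt (verit, best) power2_less_imp_less power_strict_mono zero_le_dist zero_less_numeral)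
  ultimately show ?thesis using True by (auto simp: cap_def)
qed (simp add: cap_def)

lemma contract_in_cap:
  assumes x: "x \<in> S" and r: "r \<le> 1" and z: "z \<in> cap x r" and t: "t \<in> {0..1}"
  shows "(1 - t) *\<^sub>R z + t *\<^sub>R x \<noteq> 0" "contract x t z \<in> cap x r"
proof -
  let ?w = "(1 - t) *\<^sub>R z + t *\<^sub>R x"
  have xx: "x \<bullet> x = 1" using x by (simp add: norm_eq_1)
  have z': "norm z = 1" "0 < r" "1 - r\<^sup>2 / 2 < z \<bullet> x"
    using z in_cap_iff_inner[OF x] by auto
  have "r\<^sup>2 \<le> 1" using r z'(2) by (simp add: power_le_one)
  then have zx: "0 < z \<bullet> x" using z' by linarith
  have zx1: "z \<bullet> x \<le> 1" using norm_cauchy_schwarz[of z x] z' x by simp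
  have wx: "?w \<bullet> x = (1 - t) * (z \<bullet> x) + t" by (simp add: inner_add_left xx)
  have "z \<bullet> x \<le> ?w \<bullet> x"
  proof -
    have "0 \<le> t * (1 - z \<bullet> x)" using t zx1 by simp
    then show ?thesis unfolding wx by (simp add: algebra_simps)
  qed
  with zx have wpos: "0 < ?w \<bullet> x" "z \<bullet> x \<le> ?w \<bullet> x" by auto
  then show w0: "?w \<noteq> 0" by (metis inner_zero_left less_irrefl)
  have "norm ?w \<le> (1 - t) * norm z + t * norm x"
    using t by (intro norm_triangle_le) simp
  then have w1: "norm ?w \<le> 1" using z' x by simp
  have "?w \<bullet> x \<le> sgn ?w \<bullet> x"
  proof -
    have "(?w \<bullet> x) * norm ?w \<le> ?w \<bullet> x" using w1 wpos by (simp add: mult_left_le)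
    then have "?w \<bullet> x \<le> (?w \<bullet> x) / norm ?w" 
      using w0 by (subst pos_le_divide_eq) auto
    then show ?thesis by (simp add: sgn_div_norm divide_inverse mult.commute)
  qed
  then have "1 - r\<^sup>2 / 2 < sgn ?w \<bullet> x" using wpos z' by linarith
  moreover have "sgn ?w \<in> S" using w0 by (simp add: norm_sgn)
  ultimately show "contract x t z \<in> cap x r"
    unfolding in_cap_iff_inner[OF x] contract_def using z' by blast
qed

lemma continuous_on_contract:
  assumes "x \<in> S" "r \<le> 1"
  shows "continuous_on ({0..1} \<times> cap x r) (\<lambda>(t, z). contract x t z)"
  unfolding contract_def case_prod_unfold sgn_div_norm
  using contract_in_cap(1)[OF assms] by (intro continuous_intros) auto

lemma contract_0: "z \<in> cap x r \<Longrightarrow> contract x 0 z = z"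
  by (simp add: contract_def cap_def sgn_div_norm)

lemma contract_1: "x \<in> S \<Longrightarrow> contract x 1 z = x"
  by (simp add: contract_def sgn_div_norm)

lemma path_connected_cap:
  assumes "x \<in> S" "r \<le> 1"
  shows "path_connected (cap x r)"
proof (rule contractible_imp_path_connected)
  show "contractible (cap x r)"
    unfolding contractible_def
  proof (intro exI[of _ x], subst homotopic_with, simp, 
      intro exI[of _ "\<lambda>(t, z). contract x t z"] conjI)
    show "continuous_map (prod_topology (top_of_set {0..1}) (top_of_set (cap x r)))
       (top_of_set (cap x r)) (\<lambda>(t, z). contract x t z)"
      using continuous_on_contract[OF assms] contract_in_cap(2)[OF assms]
      by auto
  qed (use assms in \<open>auto simp: contract_0 contract_1\<close>)
qed

text \<open>By the slice property two points of the cap with the same orbit differ by an element that fixes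
  \<open>x\<close>, with which the contraction commutes. So the contraction descends; the product of the interval
  with the quotient map is again a quotient map, whence the descended map is continuous.\<close>

lemma contractible_proj_cap:
  assumes x: "x \<in> S" and r: "0 < r" "r \<le> 1" 
    and slice: "\<And>A z. A \<in> G \<Longrightarrow> z \<in> cap x r \<Longrightarrow> A *v z \<in> cap x r \<Longrightarrow> A *v x = x"
  shows "contractible (proj ` cap x r)"
proof -
  let ?C = "top_of_set (cap x r)" and ?U = "top_of_set (proj ` cap x r)" and ?I = "top_of_set {0..1::real}"
  have "open_map ?C ?U proj"
    unfolding open_map_def
  proof safe
    fix V assume "openin ?C V"
    then have "openin (top_of_set (proj ` S)) (proj ` V)" "proj ` V \<subseteq> proj ` cap x r"
      by (auto intro!: openin_proj_image openin_trans[OF _ openin_cap] dest: openin_imp_subset)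
    then show "openin ?U (proj ` V)"
      by (rule openin_subset_trans) (auto simp: cap_def)
  qed
  then have "quotient_map ?C ?U proj"
    by (intro continuous_open_imp_quotient_map) (auto simp: continuous_on_proj)
  then have q: "quotient_map (prod_topology ?I ?C) (prod_topology ?I ?U) (\<lambda>(t, z). (t, proj z))"
    by (intro quotient_map_prod_right) 
       (auto simp: Hausdorff_space_subtopology intro!: compact_imp_locally_compact_space compact_space_subtopology)
  have c: "continuous_map (prod_topology ?I ?C) ?U (\<lambda>(t, z). proj (contract x t z))"
  proof -
    have "continuous_on ({0..1} \<times> cap x r) (proj \<circ> (\<lambda>(t, z). contract x t z))"
      by (intro continuous_on_compose continuous_on_contract x r continuous_on_proj)
    then show ?thesis
      using contract_in_cap(2)[OF x r(2)] by (auto simp: o_def case_prod_unfold)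
  qed
  have fib: "(case a of (t, z) \<Rightarrow> proj (contract x t z)) = (case b of (t, z) \<Rightarrow> proj (contract x t z))"
    if "a \<in> topspace (prod_topology ?I ?C)" "b \<in> topspace (prod_topology ?I ?C)"
      "(case a of (t, z) \<Rightarrow> (t, proj z)) = (case b of (t, z) \<Rightarrow> (t, proj z))" for a b
  proof -
    obtain t z s w where ab: "a = (t, z)" "b = (s, w)" by fastforce
    then have st: "s = t" "proj z = proj w" "z \<in> cap x r" "w \<in> cap x r" using that by auto
    then obtain A where A: "A \<in> G" "w = A *v z" by (auto simp: proj_eq_iff)
    then have "A *v x = x" using slice st by blast
    then have "contract x t w = A *v contract x t z" using A by (simp add: contract_act)
    then show ?thesis using A by (simp add: ab st proj_act)
  qed
  obtain h where h: "continuous_map (prod_topology ?I ?U) ?U h"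
    "\<And>a. a \<in> topspace (prod_topology ?I ?C) \<Longrightarrow> 
        h (case a of (t, z) \<Rightarrow> (t, proj z)) = (case a of (t, z) \<Rightarrow> proj (contract x t z))"
    by (rule quotient_map_lift_exists[OF q c]) (erule (2) fib, rule that)
  have h': "h (t, proj z) = proj (contract x t z)" if "t \<in> {0..1}" "z \<in> cap x r" for t z
    using h(2)[of "(t, z)"] that by simp
  show ?thesis
    unfolding contractible_def
  proof (intro exI[of _ "proj x"], subst homotopic_with, simp, intro exI[of _ h] conjI)
    show "\<forall>u\<in>topspace ?U. h (0, u) = id u" "\<forall>u\<in>topspace ?U. h (1, u) = proj x"
      using x by (auto simp: h' contract_0 contract_1)
  qed (use h in auto)
qed


section \<open>Lifting paths up to homotopy\<close>

lemma act_path: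
  assumes "A \<in> G" "path \<delta>" "path_image \<delta> \<subseteq> S"
  shows "path ((*v) A \<circ> \<delta>)" "path_image ((*v) A \<circ> \<delta>) \<subseteq> S" 
    "proj \<circ> ((*v) A \<circ> \<delta>) = proj \<circ> \<delta>"
    "pathstart ((*v) A \<circ> \<delta>) = A *v pathstart \<delta>" "pathfinish ((*v) A \<circ> \<delta>) = A *v pathfinish \<delta>"
proof -
  show "path ((*v) A \<circ> \<delta>)"
    using assms by (intro path_continuous_image) (auto intro!: linear_continuous_on)
qed (use assms in \<open>auto simp: path_image_compose norm_act proj_act pathstart_def pathfinish_def fun_eq_iff\<close>)

lemma proj_path:
  assumes "path \<delta>" "path_image \<delta> \<subseteq> S"
  shows "path (proj \<circ> \<delta>)" "path_image (proj \<circ> \<delta>) \<subseteq> proj ` S"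
  using assms by (auto simp: path_image_compose intro!: path_continuous_image continuous_on_proj)

text \<open>The path itself need not be lifted. Locally it runs in the simply connected image of a cap,
  where it is homotopic to the projection of any path in the cap with matching ends. The pieces are
  joined upstairs after translation by group elements, which the projection does not see.\<close>

lemma homotopic_to_projected_path:
  assumes f: "path f" "path_image f \<subseteq> proj ` S"
  obtains \<gamma> where "path \<gamma>" "path_image \<gamma> \<subseteq> S" "homotopic_paths (proj ` S) f (proj \<circ> \<gamma>)"
proof -
  define P where "P a b \<longleftrightarrow> a \<in> {0..1} \<longrightarrow> b \<in> {0..1} \<longrightarrow> a \<le> b \<longrightarrow>
    (\<exists>\<gamma>. path \<gamma> \<and> path_image \<gamma> \<subseteq> S \<and> homotopic_paths (proj ` S) (subpath a b f) (proj \<circ> \<gamma>))" for a b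
  have "P 0 1"
  proof (rule Bolzano[where P = P])
    fix a b c :: real
    assume P: "P a b" "P b c" and le: "a \<le> b" "b \<le> c"
    show "P a c"
      unfolding P_def
    proof (intro impI)
      assume ac: "a \<in> {0..1}" "c \<in> {0..1}"
      with le have b: "b \<in> {0..1}" by auto
      obtain \<gamma> where g: "path \<gamma>" "path_image \<gamma> \<subseteq> S" 
        "homotopic_paths (proj ` S) (subpath a b f) (proj \<circ> \<gamma>)"
        using P(1) ac b le unfolding P_def by blast
      obtain \<delta> where d: "path \<delta>" "path_image \<delta> \<subseteq> S" 
        "homotopic_paths (proj ` S) (subpath b c f) (proj \<circ> \<delta>)"
        using P(2) ac b le unfolding P_def by blast
      have "proj (pathstart \<delta>) = f b" "proj (pathfinish \<gamma>) = f b"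
        using homotopic_paths_imp_pathstart[OF d(3)] homotopic_paths_imp_pathfinish[OF g(3)]
        by (simp_all add: pathstart_compose pathfinish_compose)
      then obtain A where A: "A \<in> G" "pathfinish \<gamma> = A *v pathstart \<delta>"
        using proj_eq_iff by metis
      let ?e = "\<gamma> +++ ((*v) A \<circ> \<delta>)"
      note Ad = act_path[OF A(1) d(1,2)]
      have "path ?e" "path_image ?e \<subseteq> S"
        using g A Ad by (simp_all add: subset_path_image_join)
      moreover have "homotopic_paths (proj ` S) (subpath a c f) (proj \<circ> ?e)"
      proof -
        have "proj \<circ> ?e = (proj \<circ> \<gamma>) +++ (proj \<circ> \<delta>)"
          by (simp only: path_compose_join Ad)
        moreover have "homotopic_paths (proj ` S) (subpath a b f +++ subpath b c f) ((proj \<circ> \<gamma>) +++ (proj \<circ> \<delta>))"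
          using g(3) d(3) by (rule homotopic_paths_join) simp
        moreover have "homotopic_paths (proj ` S) (subpath a c f) (subpath a b f +++ subpath b c f)"
          using homotopic_join_subpaths[OF f ac(1) b ac(2)] by (rule homotopic_paths_sym)
        ultimately show ?thesis by (auto elim: homotopic_paths_trans)
      qed
      ultimately show "\<exists>\<gamma>. path \<gamma> \<and> path_image \<gamma> \<subseteq> S \<and> 
        homotopic_paths (proj ` S) (subpath a c f) (proj \<circ> \<gamma>)" by blast
    qed
  next
    fix x :: real assume x: "0 \<le> x" "x \<le> 1"
    then have "f x \<in> proj ` S" using f(2) by (auto simp: path_image_def)
    then obtain y where y: "y \<in> S" "f x = proj y" by blast
    obtain r where r: "0 < r" "r \<le> 1" 
      "\<And>A z. A \<in> G \<Longrightarrow> z \<in> cap y r \<Longrightarrow> A *v z \<in> cap y r \<Longrightarrow> A *v y = y"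
      using ex_slice_cap[OF y(1)] by metis
    let ?U = "proj ` cap y r"
    have sc: "simply_connected ?U"
      using contractible_proj_cap[OF y(1) r] by (rule contractible_imp_simply_connected)
    have US: "?U \<subseteq> proj ` S" by (auto simp: cap_def)
    have "openin (top_of_set {0..1}) ({0..1} \<inter> f -` ?U)"
      using f by (intro continuous_openin_preimage[OF _ _ openin_proj_image[OF openin_cap]])
        (auto simp: path_def path_image_def)
    moreover have "y \<in> cap y r" using y r by (simp add: cap_def)
    then have "x \<in> {0..1} \<inter> f -` ?U"
      using x y(2) by auto
    ultimately obtain d where d: "d > 0" "ball x d \<inter> {0..1} \<subseteq> {0..1} \<inter> f -` ?U"
      unfolding openin_contains_ball using bspec by metis
    have "P a b" if ab: "a \<le> x" "x \<le> b" "b - a < d" for a b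
      unfolding P_def
    proof (intro impI)
      assume ab01: "a \<in> {0..1}" "b \<in> {0..1}" "a \<le> b"
      have fU: "f t \<in> ?U" if "t \<in> {a..b}" for t
        using that ab ab01 by (intro vimageD[OF IntD2[OF subsetD[OF d(2)]]]) (auto simp: dist_real_def)
      obtain u v where uv: "u \<in> cap y r" "v \<in> cap y r" "f a = proj u" "f b = proj v"
        using fU[of a] fU[of b] ab01 by auto
      obtain \<gamma> where g: "path \<gamma>" "path_image \<gamma> \<subseteq> cap y r" "pathstart \<gamma> = u" "pathfinish \<gamma> = v"
        using path_connected_cap[OF y(1) r(2)] uv unfolding path_connected_def by blast
      have "homotopic_paths ?U (subpath a b f) (proj \<circ> \<gamma>)"
      proof -
        have "path (subpath a b f)" "path_image (subpath a b f) \<subseteq> ?U"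
          using f ab01 fU by (auto simp: path_image_subpath)
        moreover have "path (proj \<circ> \<gamma>)" "path_image (proj \<circ> \<gamma>) \<subseteq> ?U"
          using g by (auto simp: path_image_compose intro!: path_continuous_image continuous_on_proj)
        moreover have "pathstart (proj \<circ> \<gamma>) = pathstart (subpath a b f)"
          "pathfinish (proj \<circ> \<gamma>) = pathfinish (subpath a b f)"
          using g uv by (simp_all add: pathstart_compose pathfinish_compose)
        ultimately show ?thesis
          using sc unfolding simply_connected_eq_homotopic_paths by blast
      qed
      then have "homotopic_paths (proj ` S) (subpath a b f) (proj \<circ> \<gamma>)"
        using US by (rule homotopic_paths_subset)
      moreover have "path_image \<gamma> \<subseteq> S" using g by (auto simp: cap_def)
      ultimately show "\<exists>\<gamma>. path \<gamma> \<and> path_image \<gamma> \<subseteq> S \<and> 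
        homotopic_paths (proj ` S) (subpath a b f) (proj \<circ> \<gamma>)" using g by blast
    qed
    then show "\<exists>d>0. \<forall>a b. a \<le> x \<and> x \<le> b \<and> b - a < d \<longrightarrow> P a b"
      using d(1) by blast
  qed simp
  then show thesis using that by (auto simp: P_def)
qed

section \<open>Generation by elements with fixed points suffices\<close>

definition null :: "(real \<Rightarrow> (real^'n) \<Rightarrow>\<^sub>C real) \<Rightarrow> bool" where
  "null p \<longleftrightarrow> homotopic_paths (proj ` S) p (linepath (pathstart p) (pathstart p))"

lemma null_cong: 
  assumes "homotopic_paths (proj ` S) p q" "null q"
  shows "null p"
  using homotopic_paths_imp_pathstart[OF assms(1)] homotopic_paths_trans[OF assms(1)] assms(2)
  by (simp add: null_def)

text \<open>The paths from \<open>a\<close> to \<open>A a\<close> define the image of \<open>A\<close> in the fundamental group of the orbit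
  space; the inert elements are the kernel of this homomorphism.\<close>

definition inert :: "(real^'n^'n) \<Rightarrow> bool" where
  "inert A \<longleftrightarrow> (\<forall>\<gamma>. path \<gamma> \<and> path_image \<gamma> \<subseteq> S \<and> pathfinish \<gamma> = A *v pathstart \<gamma> \<longrightarrow> null (proj \<circ> \<gamma>))"

lemma simply_connected_S: "3 \<le> CARD('n) \<Longrightarrow> simply_connected S"
  by (rule simply_connected_sphere) simp

text \<open>The sphere is simply connected, so one path from each point is enough.\<close>

lemma inertI:
  assumes n: "3 \<le> CARD('n)"
    and "\<And>a. a \<in> S \<Longrightarrow> \<exists>\<delta>. path \<delta> \<and> path_image \<delta> \<subseteq> S \<and> pathstart \<delta> = a \<and> 
           pathfinish \<delta> = A *v a \<and> null (proj \<circ> \<delta>)"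
  shows "inert A"
  unfolding inert_def
proof (intro allI impI, elim conjE)
  fix \<gamma> assume g: "path \<gamma>" "path_image \<gamma> \<subseteq> S" "pathfinish \<gamma> = A *v pathstart \<gamma>"
  have "pathstart \<gamma> \<in> S" using g pathstart_in_path_image by blast
  then obtain \<delta> where d: "path \<delta>" "path_image \<delta> \<subseteq> S" "pathstart \<delta> = pathstart \<gamma>" 
           "pathfinish \<delta> = A *v pathstart \<gamma>" "null (proj \<circ> \<delta>)"
    using assms(2) by blast
  have "homotopic_paths S \<gamma> \<delta>"
    using simply_connected_S[OF n] g d unfolding simply_connected_eq_homotopic_paths by simp
  then have "homotopic_paths (proj ` S) (proj \<circ> \<gamma>) (proj \<circ> \<delta>)"
    by (rule homotopic_paths_continuous_image) (auto simp: continuous_on_proj)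
  then show "null (proj \<circ> \<gamma>)"
    using d(5) by (rule null_cong)
qed

lemma ex_path_S:
  assumes "3 \<le> CARD('n)" "a \<in> S" "b \<in> S"
  obtains \<delta> where "path \<delta>" "path_image \<delta> \<subseteq> S" "pathstart \<delta> = a" "pathfinish \<delta> = b"
  using simply_connected_imp_path_connected[OF simply_connected_S[OF assms(1)]] assms
  unfolding path_connected_def by metis

lemma inert_one:
  assumes "3 \<le> CARD('n)"
  shows "inert (mat 1)"
proof (rule inertI[OF assms])
  fix a :: "real^'n" assume a: "a \<in> S"
  have "proj \<circ> linepath a a = linepath (proj a) (proj a)"
    by (simp add: linepath_refl o_def)
  then have "null (proj \<circ> linepath a a)"
    using a by (simp add: null_def)
  with a show "\<exists>\<delta>. path \<delta> \<and> path_image \<delta> \<subseteq> S \<and> pathstart \<delta> = a \<and> 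
           pathfinish \<delta> = mat 1 *v a \<and> null (proj \<circ> \<delta>)"
    by (intro exI[of _ "linepath a a"]) simp
qed

text \<open>Go from \<open>a\<close> to the fixed point and return along the \<open>A\<close>-translate of the same path. Below,
  this is a path followed by its reverse.\<close>

lemma inert_fixing:
  assumes "3 \<le> CARD('n)" "A \<in> G" "x \<in> S" "A *v x = x"
  shows "inert A"
proof (rule inertI[OF assms(1)])
  fix a :: "real^'n" assume a: "a \<in> S"
  obtain \<delta> where d: "path \<delta>" "path_image \<delta> \<subseteq> S" "pathstart \<delta> = a" "pathfinish \<delta> = x"
    by (rule ex_path_S[OF assms(1) a assms(3)])
  note Ad = act_path[OF assms(2) d(1,2)]
  let ?e = "\<delta> +++ reversepath ((*v) A \<circ> \<delta>)"
  have "proj \<circ> ?e = (proj \<circ> \<delta>) +++ reversepath (proj \<circ> \<delta>)"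
    using assms(2) by (auto simp: path_compose_join path_compose_reversepath Ad)
  then have "null (proj \<circ> ?e)"
    using homotopic_paths_rinv[OF proj_path[OF d(1,2)]] by (simp add: null_def)
  then show "\<exists>\<delta>. path \<delta> \<and> path_image \<delta> \<subseteq> S \<and> pathstart \<delta> = a \<and> 
           pathfinish \<delta> = A *v a \<and> null (proj \<circ> \<delta>)"
    using d Ad assms by (intro exI[of _ ?e]) (simp add: subset_path_image_join)
qed

text \<open>A path from \<open>a\<close> to \<open>A a\<close> is continued by the \<open>A\<close>-translate of a path from \<open>a\<close> to \<open>B a\<close>, and
  below the two parts are null-homotopic separately.\<close>

lemma inert_mult:
  assumes "3 \<le> CARD('n)" "A \<in> G" "B \<in> G" "inert A" "inert B"
  shows "inert (A ** B)"
proof (rule inertI[OF assms(1)])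
  fix a :: "real^'n" assume a: "a \<in> S"
  obtain \<gamma> where g: "path \<gamma>" "path_image \<gamma> \<subseteq> S" "pathstart \<gamma> = a" "pathfinish \<gamma> = A *v a"
    using a by (rule ex_path_S[OF assms(1) a act_sphere_iff[OF assms(2), THEN iffD2]])
  obtain \<delta> where d: "path \<delta>" "path_image \<delta> \<subseteq> S" "pathstart \<delta> = a" "pathfinish \<delta> = B *v a"
    using a by (rule ex_path_S[OF assms(1) a act_sphere_iff[OF assms(3), THEN iffD2]])
  note Ad = act_path[OF assms(2) d(1,2)]
  let ?e = "\<gamma> +++ ((*v) A \<circ> \<delta>)" and ?c = "linepath (proj a) (proj a)"
  have null: "null (proj \<circ> \<gamma>)" "null (proj \<circ> \<delta>)"
    using assms g d by (auto simp: inert_def)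
  have "proj \<circ> ?e = (proj \<circ> \<gamma>) +++ (proj \<circ> \<delta>)"
    by (auto simp: path_compose_join Ad)
  moreover have "homotopic_paths (proj ` S) ((proj \<circ> \<gamma>) +++ (proj \<circ> \<delta>)) (?c +++ ?c)"
    using null g d assms(2) 
    by (intro homotopic_paths_join) (auto simp: null_def pathstart_compose pathfinish_compose proj_act)
  moreover have "null (?c +++ ?c)"
    using homotopic_paths_rid'[of ?c "proj ` S" "proj a"] a by (simp add: null_def)
  ultimately have "null (proj \<circ> ?e)"
    using null_cong by metis
  then show "\<exists>\<delta>. path \<delta> \<and> path_image \<delta> \<subseteq> S \<and> pathstart \<delta> = a \<and> 
           pathfinish \<delta> = (A ** B) *v a \<and> null (proj \<circ> \<delta>)"
    using g d Ad by (intro exI[of _ ?e]) (simp add: matrix_vector_mul_assoc subset_path_image_join)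
qed

lemma inert_transpose:
  assumes "3 \<le> CARD('n)" "A \<in> G" "inert A"
  shows "inert (transpose A)"
proof (rule inertI[OF assms(1)])
  fix a :: "real^'n" assume a: "a \<in> S"
  obtain \<delta> where d: "path \<delta>" "path_image \<delta> \<subseteq> S" "pathstart \<delta> = a" "pathfinish \<delta> = A *v a"
    using a by (rule ex_path_S[OF assms(1) a act_sphere_iff[OF assms(2), THEN iffD2]])
  have "null (proj \<circ> \<delta>)"
    using assms d by (auto simp: inert_def)
  then have "homotopic_paths (proj ` S) (reversepath (proj \<circ> \<delta>)) (reversepath (linepath (proj a) (proj a)))"
    unfolding homotopic_paths_reversepath by (simp add: null_def pathstart_compose d)
  then have null: "null (reversepath (proj \<circ> \<delta>))"
    using assms(2) by (simp add: null_def pathfinish_compose d proj_act)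
  let ?e = "(*v) (transpose A) \<circ> reversepath \<delta>"
  have "path (reversepath \<delta>)" "path_image (reversepath \<delta>) \<subseteq> S" using d by auto
  note Ad = act_path[OF transpose_closed[OF assms(2)] this]
  have "proj \<circ> ?e = reversepath (proj \<circ> \<delta>)"
    using Ad(3) path_compose_reversepath[of proj \<delta>] by (rule trans)
  with null have "null (proj \<circ> ?e)"
    by simp
  then show "\<exists>\<delta>. path \<delta> \<and> path_image \<delta> \<subseteq> S \<and> pathstart \<delta> = a \<and> 
           pathfinish \<delta> = transpose A *v a \<and> null (proj \<circ> \<delta>)"
    using Ad d assms(2) by (intro exI[of _ ?e]) (auto simp: transpose_act)
qed

text \<open>The hypothesis \<open>gen\<close> says that the elements with fixed points generate \<open>G\<close>. It is applied to
  the subgroup of inert elements.\<close>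

theorem simply_connected_quotientI:
  assumes n: "3 \<le> CARD('n)"
    and gen: "\<And>N. N \<subseteq> G \<Longrightarrow> finite_orthogonal_group N \<Longrightarrow> 
        {A \<in> G. \<exists>x\<in>S. A *v x = x} \<subseteq> N \<Longrightarrow> N = G"
  shows "simply_connected (proj ` S)"
proof -
  let ?N = "{A \<in> G. inert A}"
  have "finite_orthogonal_group ?N"
    using n by unfold_locales 
      (auto simp: finite_G one_closed mult_closed transpose_closed orthogonal inert_one inert_mult inert_transpose)
  then have "?N = G"
    using n by (intro gen) (auto intro: inert_fixing)
  then have inert: "inert A" if "A \<in> G" for A using that by blast
  show ?thesis
    unfolding simply_connected_eq_contractible_path
  proof (intro conjI allI impI, goal_cases)
    case 1
    then show ?case
      using simply_connected_imp_path_connected[OF simply_connected_S[OF n]]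
      by (intro path_connected_continuous_image continuous_on_proj)
  next
    case (2 p)
    then obtain \<gamma> where g: "path \<gamma>" "path_image \<gamma> \<subseteq> S" "homotopic_paths (proj ` S) p (proj \<circ> \<gamma>)"
      using homotopic_to_projected_path by metis
    have "proj (pathstart \<gamma>) = proj (pathfinish \<gamma>)"
      using homotopic_paths_imp_pathstart[OF g(3)] homotopic_paths_imp_pathfinish[OF g(3)] 2
      by (simp add: pathstart_compose pathfinish_compose)
    then obtain A where "A \<in> G" "pathfinish \<gamma> = A *v pathstart \<gamma>"
      using proj_eq_iff by blast
    then have "null (proj \<circ> \<gamma>)"
      using inert g by (auto simp: inert_def)
    with g(3) have "null p" by (rule null_cong)
    then show ?case unfolding null_def .
  qed
qed


section \<open>Generation by elements with fixed points is necessary\<close>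

text \<open>The image of a slice cap is evenly covered, and the sheets are the images of the translated
  caps. Two sheets that meet coincide: by the slice property an element of \<open>N\<close> that takes a point of
  one translate into the other also takes centre to centre, hence cap to cap. Each sheet is mapped
  injectively, because two of its points in one orbit of \<open>G\<close> differ by an element that fixes the
  centre, and such elements are in \<open>N\<close>.\<close>

lemma covering_space_proj:
  assumes N: "finite_orthogonal_group N" "N \<subseteq> G" 
    and fixing: "\<And>A x. A \<in> G \<Longrightarrow> x \<in> S \<Longrightarrow> A *v x = x \<Longrightarrow> A \<in> N"
  obtains p where "covering_space (finite_orthogonal_group.proj N ` S) p (proj ` S)"
    "\<And>x. x \<in> S \<Longrightarrow> p (finite_orthogonal_group.proj N x) = proj x"
proof -
  interpret N: finite_orthogonal_group N by fact
  have factor: "proj x = proj y" if "N.proj x = N.proj y" for x y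
    using that N(2) by (auto simp: N.proj_eq_iff proj_eq_iff)
  have "continuous_map (top_of_set S) (top_of_set (proj ` S)) proj"
    by (auto simp: continuous_on_proj)
  then obtain p where "continuous_map (top_of_set (N.proj ` S)) (top_of_set (proj ` S)) p"
    "\<And>x. x \<in> topspace (top_of_set S) \<Longrightarrow> p (N.proj x) = proj x"
    by (rule quotient_map_lift_exists[OF N.quotient_map_proj]) (erule factor, rule that)
  then have contp: "continuous_on (N.proj ` S) p" and p: "\<And>x. x \<in> S \<Longrightarrow> p (N.proj x) = proj x"
    by auto
  have "covering_space (N.proj ` S) p (proj ` S)"
  proof
    show "p ` N.proj ` S = proj ` S" using p by (force simp: image_image)
    fix y assume "y \<in> proj ` S"
    then obtain x where x: "x \<in> S" "y = proj x" by blast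
    obtain r where r: "0 < r" "r \<le> 1" 
      and slice: "\<And>A z. A \<in> G \<Longrightarrow> z \<in> cap x r \<Longrightarrow> A *v z \<in> cap x r \<Longrightarrow> A *v x = x"
      using ex_slice_cap[OF x(1)] by metis
    let ?T = "proj ` cap x r"
    define V where "V A = N.proj ` cap (A *v x) r" for A
    have capS: "cap z r \<subseteq> S" for z by (auto simp: cap_def)
    have V_eq: "V A = V B" if A: "A \<in> G" and B: "B \<in> G" and ne: "\<not> disjnt (V A) (V B)" for A B
    proof -
      obtain z w where zw: "z \<in> cap (A *v x) r" "w \<in> cap (B *v x) r" "N.proj z = N.proj w"
        using ne unfolding V_def disjnt_def by auto
      then obtain h where h: "h \<in> N" "w = h *v z" by (auto simp: N.proj_eq_iff)
      then have hG: "h \<in> G" using N(2) by blast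
      \<comment> \<open>The element that maps a point of the cap about \<open>x\<close> into that cap, by way of the two
        translates that meet modulo \<open>N\<close>.\<close>
      let ?C = "transpose B ** (h ** A)" and ?z = "transpose A *v z"
      have C: "?C \<in> G" using A B hG mult_closed transpose_closed by blast
      have "?z \<in> cap x r" using zw(1) cap_act_iff[OF A, of ?z x r] A by (simp add: transpose_act)
      moreover have "?C *v ?z \<in> cap x r"
        using zw(2) cap_act_iff[OF B, of "?C *v ?z" x r] A B h
        by (simp add: transpose_act flip: matrix_vector_mul_assoc)
      ultimately have "?C *v x = x" using slice C by blast
      then have "B *v (transpose B *v (h *v (A *v x))) = B *v x"
        by (simp flip: matrix_vector_mul_assoc)
      then have hAB: "h *v (A *v x) = B *v x" using B by (simp add: transpose_act)
      show ?thesis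
      proof (intro equalityI subsetI)
        fix u assume "u \<in> V A"
        then obtain c where c: "c \<in> cap (A *v x) r" "u = N.proj c" unfolding V_def by blast
        have "h *v c \<in> cap (B *v x) r" using cap_act_iff[OF hG, of c "A *v x" r] c hAB by simp
        moreover have "u = N.proj (h *v c)" using c h by (simp add: N.proj_act)
        ultimately show "u \<in> V B" unfolding V_def by blast
      next
        fix u assume "u \<in> V B"
        then obtain c where c: "c \<in> cap (B *v x) r" "u = N.proj c" unfolding V_def by blast
        let ?c = "transpose h *v c"
        have "?c \<in> cap (A *v x) r" 
          using cap_act_iff[OF hG, of ?c "A *v x" r] c hAB hG by (simp add: transpose_act)
        moreover have "u = N.proj ?c" using c h N.transpose_closed by (simp add: N.proj_act)
        ultimately show "u \<in> V A" unfolding V_def by blast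
      qed
    qed
    have pV: "p ` V A = ?T" if A: "A \<in> G" for A
    proof -
      have "p ` V A = proj ` cap (A *v x) r"
        using p subsetD[OF capS] unfolding V_def image_image by (intro image_cong) blast+
      also have "cap (A *v x) r = (*v) A ` cap x r"
      proof (intro equalityI subsetI)
        fix c assume "c \<in> cap (A *v x) r"
        then have "transpose A *v c \<in> cap x r" "c = A *v (transpose A *v c)"
          using cap_act_iff[OF A, of "transpose A *v c" x r] A by (simp_all add: transpose_act)
        then show "c \<in> (*v) A ` cap x r" by blast
      qed (use A in \<open>auto simp: cap_act_iff\<close>)
      also have "proj ` \<dots> = ?T" using A by (simp add: image_image proj_act)
      finally show ?thesis .
    qed
    have openV: "openin (top_of_set (N.proj ` S)) (V A)" for A
      unfolding V_def by (intro N.openin_proj_image openin_cap)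
    have openT: "openin (top_of_set (proj ` S)) ?T"
      by (intro openin_proj_image openin_cap)
    have union: "\<Union> (V ` G) = N.proj ` S \<inter> p -` ?T"
    proof (intro equalityI subsetI)
      fix u assume "u \<in> \<Union> (V ` G)"
      then obtain A where A: "A \<in> G" "u \<in> V A" by blast
      then have "u \<in> N.proj ` S" using capS unfolding V_def by blast
      moreover have "p u \<in> ?T" using A pV by blast
      ultimately show "u \<in> N.proj ` S \<inter> p -` ?T" by blast
    next
      fix u assume u: "u \<in> N.proj ` S \<inter> p -` ?T"
      then obtain z where z: "z \<in> S" "u = N.proj z" by blast
      then obtain c where c: "c \<in> cap x r" "proj c = proj z" using u p by auto
      then obtain A where A: "A \<in> G" "z = A *v c" by (auto simp: proj_eq_iff)
      then have "z \<in> cap (A *v x) r" using c cap_act_iff by blast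
      then show "u \<in> \<Union> (V ` G)" using A z unfolding V_def by blast
    qed
    have homeo: "\<exists>q. homeomorphism (V A) ?T p q" if A: "A \<in> G" for A
    proof -
      have VS: "V A \<subseteq> N.proj ` S" using capS unfolding V_def by blast
      have "inj_on p (V A)"
      proof (rule inj_onI)
        fix u v assume uv: "u \<in> V A" "v \<in> V A" "p u = p v"
        then obtain z w where zw: "z \<in> cap (A *v x) r" "w \<in> cap (A *v x) r" "u = N.proj z" "v = N.proj w"
          unfolding V_def by blast
        then have "proj z = proj w" using uv p capS by (metis subsetD)
        then obtain B where B: "B \<in> G" "w = B *v z" by (auto simp: proj_eq_iff)
        then have "B *v (A *v x) = A *v x"
          using zw by (intro slice_cap_act[where r = r and z = z, OF A _ B(1)]) (erule (2) slice, auto)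
        then have "B \<in> N" using fixing[OF B(1), of "A *v x"] x(1) A by (simp add: norm_act)
        then show "u = v" using zw B by (simp add: N.proj_act)
      qed
      moreover have "openin (top_of_set ?T) (p ` W)" if W: "openin (top_of_set (V A)) W" for W
      proof -
        have W': "openin (top_of_set (N.proj ` S)) W"
          using W openV by (rule openin_trans)
        then have WS: "W \<subseteq> N.proj ` S" by (rule openin_imp_subset)
        have "openin (top_of_set S) (S \<inter> N.proj -` W)"
          by (rule continuous_openin_preimage[OF N.continuous_on_proj _ W']) auto
        then have "openin (top_of_set (proj ` S)) (proj ` (S \<inter> N.proj -` W))"
          by (rule openin_proj_image)
        also have "proj ` (S \<inter> N.proj -` W) = p ` W"
        proof -
          have "W = N.proj ` (S \<inter> N.proj -` W)" using WS by blast
          then have "p ` W = p ` N.proj ` (S \<inter> N.proj -` W)" by simp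
          also have "\<dots> = proj ` (S \<inter> N.proj -` W)"
            unfolding image_image using p by (intro image_cong) auto
          finally show ?thesis by simp
        qed
        finally show ?thesis
        proof (rule openin_subset_trans)
          show "p ` W \<subseteq> ?T" using pV[OF A] openin_imp_subset[OF W] by blast
          show "?T \<subseteq> proj ` S" using capS by blast
        qed
      qed
      ultimately show ?thesis
        using homeomorphism_injective_open_map[OF continuous_on_subset[OF contp VS] pV[OF A]] by metis
    qed
    show "\<exists>T. y \<in> T \<and> openin (top_of_set (proj ` S)) T \<and>
           (\<exists>v. \<Union> v = N.proj ` S \<inter> p -` T \<and> (\<forall>u\<in>v. openin (top_of_set (N.proj ` S)) u) \<and>
                pairwise disjnt v \<and> (\<forall>u\<in>v. \<exists>q. homeomorphism u T p q))"
    proof (intro exI[of _ ?T] exI[of _ "V ` G"] conjI)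
      show "y \<in> ?T" using x r by (auto simp: cap_def)
      show "pairwise disjnt (V ` G)" using V_eq by (auto simp: pairwise_def)
    qed (use openT union openV homeo in auto)
  qed (fact contp)
  then show thesis using p that by blast
qed

text \<open>Both the projection of a path from \<open>x\<close> to \<open>A x\<close> to the orbit space of \<open>N\<close> and the constant path
  lift homotopic loops below, so by monodromy they have the same end.\<close>

theorem simply_connected_quotientD:
  assumes n: "3 \<le> CARD('n)" and sc: "simply_connected (proj ` S)"
    and N: "finite_orthogonal_group N" "N \<subseteq> G" 
    and fixing: "\<And>A x. A \<in> G \<Longrightarrow> x \<in> S \<Longrightarrow> A *v x = x \<Longrightarrow> A \<in> N"
  shows "N = G"
proof (intro equalityI subsetI)
  interpret N: finite_orthogonal_group N by fact
  obtain p where cov: "covering_space (N.proj ` S) p (proj ` S)"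
    and p: "\<And>x. x \<in> S \<Longrightarrow> p (N.proj x) = proj x"
    by (rule covering_space_proj[OF N]) (erule (2) fixing, rule that)
  fix A assume A: "A \<in> G"
  obtain x :: "real^'n" where x: "x \<in> S" 
    using vector_choose_size[of 1] by auto
  obtain \<gamma> where g: "path \<gamma>" "path_image \<gamma> \<subseteq> S" "pathstart \<gamma> = x" "pathfinish \<gamma> = A *v x"
    using x by (rule ex_path_S[OF n x act_sphere_iff[OF A, THEN iffD2]])
  note Np = N.proj_path[OF g(1,2)] and Gp = proj_path[OF g(1,2)]
  have hom: "homotopic_paths (proj ` S) (proj \<circ> \<gamma>) (linepath (proj x) (proj x))"
  proof -
    have "pathstart (proj \<circ> \<gamma>) = proj x" "pathfinish (proj \<circ> \<gamma>) = proj x"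
      by (simp_all only: pathstart_compose pathfinish_compose g(3,4) proj_act[OF A])
    then show ?thesis
      using simply_connected_imp_contractible_loop[OF sc Gp] by blast
  qed
  have "pathfinish (N.proj \<circ> \<gamma>) = pathfinish (linepath (N.proj x) (N.proj x))"
  proof (rule covering_space_monodromy[OF cov Gp _ _ hom Np])
    show "p ((N.proj \<circ> \<gamma>) t) = (proj \<circ> \<gamma>) t" if "t \<in> {0..1}" for t
    proof -
      have "\<gamma> t \<in> S" using g(2) that unfolding path_image_def by blast
      then show ?thesis using p by (simp only: o_apply)
    qed
    show "p (linepath (N.proj x) (N.proj x) t) = linepath (proj x) (proj x) t" for t
      using p[OF x] by (simp add: linepath_refl)
  qed (use x g in \<open>auto simp: pathstart_compose\<close>)
  then have "N.proj x = N.proj (A *v x)"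
    using g by (simp add: pathfinish_compose)
  then obtain B where B: "B \<in> N" "A *v x = B *v x" by (auto simp: N.proj_eq_iff)
  have "(transpose B ** A) *v x = x"
    using B N(2) by (auto simp: transpose_act simp flip: matrix_vector_mul_assoc)
  moreover have "transpose B ** A \<in> G"
    using A B N(2) mult_closed transpose_closed by blast
  ultimately have "transpose B ** A \<in> N" using fixing x by blast
  then have "B ** (transpose B ** A) \<in> N" using B N.mult_closed by blast
  moreover have "B ** (transpose B ** A) = A"
    using N.orthogonal[OF B(1)] by (simp add: matrix_mul_assoc orthogonal_matrix_def)
  ultimately show "A \<in> N" by simp
qed (use N in auto)

end


section \<open>Rotations\<close>

text \<open>A rotation moves an axis to the line of \<open>v\<close>; the reflection along \<open>v\<close> is conjugate to the one along the axis,
  which is a diagonal matrix.\<close>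

lemma ex_reflection:
  fixes v :: "real^'n"
  assumes "v \<noteq> 0" "2 \<le> CARD('n)"
  obtains R :: "real^'n^'n" where "orthogonal_matrix R" "det R = -1" "R *v v = - v"
    "\<And>w. v \<bullet> w = 0 \<Longrightarrow> R *v w = w"
proof -
  obtain k :: 'n where True by blast
  obtain Q :: "real^'n^'n" where Q: "rotation_matrix Q" "Q *v axis k 1 = sgn v"
    using rotation_matrix_exists_basis[OF assms(2), of "sgn v" k] assms(1) by (auto simp: norm_sgn)
  then have oQ: "orthogonal_matrix Q" and dQ: "det Q = 1" by (auto simp: rotation_matrix_def)
  define D :: "real^'n^'n" where "D = (\<chi> i j. if i = j then if i = k then - 1 else 1 else 0)"
  have Dv: "D *v u = (\<chi> i. if i = k then - u $ i else u $ i)" for u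
    by (simp add: D_def matrix_vector_mult_def vec_eq_iff if_distrib[of "\<lambda>c. c * _"] cong: if_cong)
  have "transpose D = D" by (auto simp: D_def transpose_def vec_eq_iff)
  moreover have "D ** D = mat 1"
    by (rule iffD2[OF matrix_eq]) (simp add: Dv vec_eq_iff flip: matrix_vector_mul_assoc)
  ultimately have oD: "orthogonal_matrix D" by (simp add: orthogonal_matrix)
  have "det D = (\<Prod>i\<in>UNIV. D $ i $ i)" by (rule det_diagonal) (simp add: D_def)
  also have "\<dots> = (\<Prod>i\<in>UNIV. if i = k then - 1 else 1)" by (simp add: D_def)
  also have "\<dots> = - 1" by simp
  finally have dD: "det D = - 1" .
  let ?R = "Q ** D ** transpose Q"
  have v: "norm v *\<^sub>R (Q *v axis k 1) = v"
    unfolding Q(2) using assms(1) by (simp add: sgn_div_norm)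
  show thesis
  proof
    show "orthogonal_matrix ?R" using oQ oD by (intro orthogonal_matrix_mul) auto
    show "det ?R = - 1" by (simp add: det_mul dQ dD)
    have "?R *v (Q *v axis k 1) = Q *v (D *v axis k 1)"
      by (simp add: orthogonal_matrix_transpose_cancel[OF oQ] flip: matrix_vector_mul_assoc)
    also have "D *v axis k 1 = - axis k 1" by (simp add: Dv axis_def vec_eq_iff)
    finally have "?R *v (Q *v axis k 1) = - (Q *v axis k 1)"
      using matrix_vector_mult_scaleR[of Q "-1" "axis k 1"] by simp
    then have "?R *v (norm v *\<^sub>R (Q *v axis k 1)) = - (norm v *\<^sub>R (Q *v axis k 1))"
      by (simp only: matrix_vector_mult_scaleR scaleR_minus_right)
    then show "?R *v v = - v"
      by (simp only: v)
    fix w assume w: "v \<bullet> w = 0"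
    have "(transpose Q *v w) $ k = axis k 1 \<bullet> (transpose Q *v w)"
      by (simp add: inner_axis')
    also have "\<dots> = (Q *v axis k 1) \<bullet> w"
      using dot_lmul_matrix[of w Q "axis k 1"] 
      by (simp add: transpose_matrix_vector inner_commute)
    also have "\<dots> = 0" using w Q by (simp add: sgn_div_norm)
    finally have "D *v (transpose Q *v w) = transpose Q *v w" by (simp add: Dv vec_eq_iff)
    then show "?R *v w = w" 
      by (simp add: orthogonal_matrix_transpose_cancel[OF oQ] flip: matrix_vector_mul_assoc)
  qed
qed

text \<open>Since \<open>B\<^sup>T (B - 1) = (1 - B)\<^sup>T\<close> and the dimension is even, \<open>det (B - 1)\<close> is multiplied by
  \<open>det B = -1\<close> without changing, and hence it vanishes.\<close>

lemma rotoinversion_fixed_vector: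
  fixes B :: "real^'n^'n"
  assumes "orthogonal_matrix B" "det B = -1" "even CARD('n)"
  obtains w where "w \<noteq> 0" "B *v w = w"
proof -
  \<comment> \<open>The negative of a matrix, written as a product with the scalar matrix \<open>-1\<close>.\<close>
  have "det (mat 1 - B) = det ((\<chi> i j. if i = j then -1 else 0) ** (B - mat 1))"
    by (rule arg_cong[where f = det])
       (auto simp: matrix_matrix_mult_def vec_eq_iff if_distrib[of "\<lambda>c. c * _"] cong: if_cong)
  also have "\<dots> = det (B - mat 1)"
    using assms(3) by (simp add: det_mul det_diagonal)
  finally have neg: "det (mat 1 - B) = det (B - mat 1)" .
  have "transpose B ** (B - mat 1) = mat 1 - transpose B"
    using assms(1) by (auto simp: matrix_eq matrix_vector_mult_diff_rdistrib matrix_vector_mult_diff_distrib 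
        orthogonal_matrix_transpose_cancel simp flip: matrix_vector_mul_assoc)
  also have "\<dots> = transpose (mat 1 - B)"
    by (auto simp: transpose_def vec_eq_iff mat_def)
  finally have "det B * det (B - mat 1) = det (mat 1 - B)"
    by (metis det_mul det_transpose)
  then have "det (B - mat 1) = 0" using assms(2) neg by simp
  then have "\<not> (\<forall>w. (B - mat 1) *v w = 0 \<longrightarrow> w = 0)"
    using invertible_det_nz invertible_left_inverse matrix_left_invertible_ker by metis
  then show thesis
    using that by (auto simp: matrix_vector_mult_diff_rdistrib)
qed

text \<open>Let \<open>R\<close> be the reflection along \<open>v\<close>. The orthogonal matrix \<open>A R\<close> has determinant \<open>-1\<close>, so it fixes
  some \<open>w\<close>. As it maps \<open>v\<close> to \<open>-v\<close>, the vector \<open>w\<close> is orthogonal to \<open>v\<close>. Then \<open>R\<close> fixes \<open>w\<close>,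
  and so does \<open>A\<close>.\<close>

lemma rotation_matrix_second_fixed_vector:
  fixes A :: "real^'n^'n"
  assumes "rotation_matrix A" "even CARD('n)" "v \<noteq> 0" "A *v v = v"
  obtains w where "w \<noteq> 0" "v \<bullet> w = 0" "A *v w = w"
proof -
  have A: "orthogonal_matrix A" "det A = 1" using assms(1) by (auto simp: rotation_matrix_def)
  have "2 \<le> CARD('n)" using assms(2) by (metis One_nat_def Suc_1 Suc_leI le_neq_implies_less odd_one zero_less_card_finite)
  then obtain R :: "real^'n^'n" where R: "orthogonal_matrix R" "det R = -1" "R *v v = - v"
    "\<And>w. v \<bullet> w = 0 \<Longrightarrow> R *v w = w"
    using ex_reflection[OF assms(3)] by blast
  let ?B = "A ** R"
  have oB: "orthogonal_matrix ?B" using A R by (intro orthogonal_matrix_mul)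
  have "det ?B = -1" by (simp add: det_mul A R)
  then obtain w where w: "w \<noteq> 0" "?B *v w = w"
    using rotoinversion_fixed_vector[OF oB _ assms(2)] by blast
  have "?B *v v = - v"
    using R(3) assms(4) matrix_vector_mult_scaleR[of A "-1" v] by (simp flip: matrix_vector_mul_assoc)
  moreover have "(?B *v v) \<bullet> (?B *v w) = v \<bullet> w"
    using oB orthogonal_transformation_matrix[of "(*v) ?B"] by (simp add: orthogonal_transformation_def)
  ultimately have vw: "v \<bullet> w = 0" using w by simp
  then have "A *v w = w" using w R(4) by (simp flip: matrix_vector_mul_assoc)
  then show thesis using that w vw by blast
qed

lemma is_rotation_iff_fixed_point:
  fixes A :: "real^4^4"
  assumes "rotation_matrix A"
  shows "is_rotation A \<longleftrightarrow> (\<exists>x\<in>sphere 0 1. A *v x = x)"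
proof
  assume "is_rotation A"
  then obtain V where V: "subspace V" "dim V + 2 = CARD(4)" "\<forall>v\<in>V. A *v v = v"
    by (auto simp: is_rotation_def)
  have "\<not> V \<subseteq> {0}" using V(2) dim_eq_0[of V] by auto
  then obtain v where v: "v \<in> V" "v \<noteq> 0" by blast
  then have "sgn v \<in> V" using V(1) by (simp add: sgn_div_norm subspace_scale)
  then show "\<exists>x\<in>sphere 0 1. A *v x = x"
    using V(3) v by (intro bexI[of _ "sgn v"]) (auto simp: norm_sgn)
next
  assume "\<exists>x\<in>sphere 0 1. A *v x = x"
  then obtain v where v: "norm v = 1" "A *v v = v" by auto
  then have v0: "v \<noteq> 0" by auto
  obtain w where w: "w \<noteq> 0" "v \<bullet> w = 0" "A *v w = w"
    using rotation_matrix_second_fixed_vector[OF assms _ v0 v(2)] by auto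
  have "v \<noteq> w" using w by auto
  have "pairwise orthogonal {v, w}" using w by (auto simp: pairwise_def orthogonal_def inner_commute)
  then have "independent {v, w}" using pairwise_orthogonal_independent v0 w by blast
  then have "dim (span {v, w}) = 2" using \<open>v \<noteq> w\<close> by (simp add: dim_eq_card_independent)
  moreover have "A *v u = u" if "u \<in> span {v, w}" for u
    using that
    by (induction rule: span_induct_alt)
       (auto simp: matrix_vector_right_distrib matrix_vector_mult_scaleR v w)
  ultimately show "is_rotation A"
    using assms unfolding is_rotation_def by (intro conjI exI[of _ "span {v, w}"]) auto
qed

section \<open>Discrete subgroups of the orthogonal group\<close>

text \<open>An infinite bounded set has a limit point, so it contains distinct \<open>A\<close> and \<open>B\<close> for which
  \<open>A\<^sup>T B\<close> is as close to the identity as desired; but the identity is isolated.\<close>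

lemma finite_discrete_orthogonal_group:
  fixes G :: "(real^'n^'n) set"
  assumes "discrete G" "mat 1 \<in> G"
    and "\<And>A B. A \<in> G \<Longrightarrow> B \<in> G \<Longrightarrow> transpose A ** B \<in> G"
    and orth: "\<And>A. A \<in> G \<Longrightarrow> orthogonal_matrix A"
  shows "finite G"
proof (rule ccontr)
  assume inf: "infinite G"
  have "bounded G"
  proof (rule boundedI)
    fix A assume "A \<in> G"
    then have "norm (row i A) = 1" for i
      using orth orthogonal_matrix_orthonormal_rows by blast
    then have "norm (A $ i) = 1" for i by (simp add: row_def)
    then show "norm A \<le> of_nat CARD('n)"
      unfolding norm_vec_def[of A] using L2_set_le_sum[of UNIV "\<lambda>i. norm (A $ i)"] by simp
  qed
  then obtain L where L: "L islimpt G"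
    using bounded_infinite_imp_islimpt[OF subset_refl _ inf] by blast
  have "mat 1 isolated_in G" using assms discreteD by blast
  then obtain e where e: "e > 0" "\<And>B. B \<in> G \<Longrightarrow> dist (mat 1) B < e \<Longrightarrow> B = mat 1"
    by (auto simp: isolated_in_dist_Ex_iff)
  define f where "f p = transpose (fst p) ** snd p" for p :: "(real^'n^'n) \<times> (real^'n^'n)"
  have "f = (\<lambda>p. \<chi> i j. \<Sum>k\<in>UNIV. fst p $ k $ i * snd p $ k $ j)"
    by (auto simp: f_def fun_eq_iff matrix_matrix_mult_def transpose_def)
  then have "continuous_on UNIV f"
    by (auto intro!: continuous_intros)
  then obtain d where d: "d > 0" "\<And>p. dist p (L, L) < d \<Longrightarrow> dist (f p) (f (L, L)) < e / 2"
    using e(1) unfolding continuous_on_iff by (metis UNIV_I half_gt_zero)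
  obtain A where A: "A \<in> G" "A \<noteq> L" "dist A L < d / 2"
    using L d(1) unfolding islimpt_approachable by (metis half_gt_zero)
  obtain B where B: "B \<in> G" "dist B L < dist A L"
    using L A(2) unfolding islimpt_approachable by (metis zero_less_dist_iff)
  have near: "dist (X, Y) (L, L) < d" if "dist X L < d / 2" "dist Y L < d / 2" for X Y
    using that sqrt_sum_squares_le_sum[of "dist X L" "dist Y L"] by (simp add: dist_Pair_Pair)
  have "dist (f (A, A)) (f (L, L)) < e / 2" "dist (f (A, B)) (f (L, L)) < e / 2"
    by (rule d(2), rule near; use A B in linarith)+
  then have "dist (f (A, A)) (f (A, B)) < e"
    by (rule dist_triangle_half_l)
  moreover have "f (A, A) = mat 1" using orth[OF A(1)] by (simp add: f_def orthogonal_matrix)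
  ultimately have AB: "transpose A ** B = mat 1"
    using e(2)[of "f (A, B)"] assms(3)[OF A(1) B(1)] by (simp add: f_def)
  have "A ** (transpose A ** B) = B"
    using orth[OF A(1)] by (simp add: matrix_mul_assoc orthogonal_matrix_def)
  then have "B = A" by (simp add: AB)
  then show False using B by simp
qed

section \<open>Fundamental groups of orbit spaces\<close>

lemma loop_homotopic_top_of_set_iff:
  assumes "f 0 = p" "f 1 = p"
  shows "loop_homotopic (top_of_set T) p f g \<longleftrightarrow> homotopic_paths T f g"
  using assms by (simp add: loop_homotopic_def homotopic_paths_def pathstart_def pathfinish_def)

lemma loop_homotopic_compose:
  assumes "continuous_map X Y h" "loop_homotopic X p f g"
  shows "loop_homotopic Y (h p) (h \<circ> f) (h \<circ> g)"
  using assms(2) unfolding loop_homotopic_def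
  by (rule homotopic_with_compose_continuous_map_left[OF _ assms(1)]) simp

text \<open>Loops and their homotopies are transported along the homeomorphism in both directions. The
  composition of the two transports agrees with the original loop on the unit interval only, which is
  all that homotopy depends on.\<close>

lemma trivial_fundamental_groups_iff_simply_connected:
  fixes T :: "'b::real_normed_vector set"
  assumes "homeomorphic_map X (top_of_set T) e" "path_connected T"
  shows "(\<forall>p\<in>topspace X. trivial_group (fundamental_group X p)) \<longleftrightarrow> simply_connected T"
proof -
  obtain d where ed: "homeomorphic_maps X (top_of_set T) e d"
    using assms(1) homeomorphic_map_maps by blast
  then have e: "continuous_map X (top_of_set T) e" and d: "continuous_map (top_of_set T) X d"
    and de: "\<And>x. x \<in> topspace X \<Longrightarrow> d (e x) = x" and ed: "\<And>y. y \<in> T \<Longrightarrow> e (d y) = y"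
    by (auto simp: homeomorphic_maps_def)
  have eT: "e x \<in> T" if "x \<in> topspace X" for x
    using e that by (auto simp: continuous_map_def)
  have dX: "d y \<in> topspace X" if "y \<in> T" for y
    using d that by (auto simp: continuous_map_def)
  have "(\<forall>p\<in>topspace X. \<forall>f\<in>loops_at X p. loop_homotopic X p f (\<lambda>_. p)) \<longleftrightarrow> simply_connected T"
  proof
    assume L: "\<forall>p\<in>topspace X. \<forall>f\<in>loops_at X p. loop_homotopic X p f (\<lambda>_. p)"
    have "homotopic_paths T p (linepath (pathstart p) (pathstart p))"
      if p: "path p" "path_image p \<subseteq> T" "pathfinish p = pathstart p" for p
    proof -
      let ?a = "pathstart p"
      have pT: "p t \<in> T" if "t \<in> {0..1}" for t using p(2) that by (auto simp: path_image_def)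
      have p01: "p 0 = ?a" "p 1 = ?a" using p(3) by (auto simp: pathstart_def pathfinish_def)
      have a: "?a \<in> T" using p(2) pathstart_in_path_image by blast
      have "pathin X (d \<circ> p)"
        unfolding pathin_def
        by (rule continuous_map_compose[OF _ d]) (use p(1) pT in \<open>auto simp: path_def\<close>)
      then have "d \<circ> p \<in> loops_at X (d ?a)"
        using p01 by (simp add: loops_at_def)
      then have "loop_homotopic X (d ?a) (d \<circ> p) (\<lambda>_. d ?a)" using L dX[OF a] by blast
      from loop_homotopic_compose[OF e this]
      have "homotopic_paths T (e \<circ> (d \<circ> p)) (e \<circ> (\<lambda>_. d ?a))"
        by (subst (asm) loop_homotopic_top_of_set_iff) (simp_all add: p01)
      moreover have "e \<circ> (\<lambda>_. d ?a) = linepath ?a ?a"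
        by (simp add: linepath_refl o_def ed[OF a])
      moreover have "homotopic_paths T p (e \<circ> (d \<circ> p))"
        using p pT by (intro homotopic_paths_eq) (simp_all add: ed)
      ultimately show ?thesis by (auto elim: homotopic_paths_trans)
    qed
    then show "simply_connected T"
      unfolding simply_connected_eq_contractible_path using assms(2) by blast
  next
    assume R: "simply_connected T"
    show "\<forall>p\<in>topspace X. \<forall>f\<in>loops_at X p. loop_homotopic X p f (\<lambda>_. p)"
    proof (intro ballI)
      fix p f assume p: "p \<in> topspace X" and f: "f \<in> loops_at X p"
      then have f': "continuous_map (top_of_set {0..1}) X f" "f 0 = p" "f 1 = p"
        by (auto simp: loops_at_def pathin_def)
      have fX: "f t \<in> topspace X" if "t \<in> {0..1}" for t
        using f'(1) that by (auto simp: continuous_map_def)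
      have "continuous_map (top_of_set {0..1}) (top_of_set T) (e \<circ> f)"
        using f'(1) e by (rule continuous_map_compose)
      then have "path (e \<circ> f)" "path_image (e \<circ> f) \<subseteq> T"
        by (auto simp: path_def path_image_def)
      moreover have ends: "pathstart (e \<circ> f) = e p" "pathfinish (e \<circ> f) = e p"
        by (simp_all add: pathstart_def pathfinish_def f')
      ultimately have "homotopic_paths T (e \<circ> f) (linepath (e p) (e p))"
        using simply_connected_imp_contractible_loop[OF R] by blast
      then have "loop_homotopic (top_of_set T) (e p) (e \<circ> f) (linepath (e p) (e p))"
        by (subst loop_homotopic_top_of_set_iff) (simp_all add: f')
      from loop_homotopic_compose[OF d this]
      have "loop_homotopic X p (d \<circ> (e \<circ> f)) (\<lambda>_. p)"
        using p by (simp add: de linepath_refl o_def)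
      moreover have "loop_homotopic X p f (d \<circ> (e \<circ> f))"
        unfolding loop_homotopic_def
        by (rule homotopic_with_equal) (use f' fX p in \<open>auto simp: de\<close>)
      ultimately show "loop_homotopic X p f (\<lambda>_. p)" by (rule loop_homotopic_trans[rotated])
    qed
  qed
  then show ?thesis by (simp add: trivial_fundamental_group_iff)
qed

text \<open>The projections from the sphere to both spaces are quotient maps with the same fibres.\<close>

lemma (in finite_orthogonal_group) homeomorphic_orbit_space:
  "homeomorphic_map (orbit_space (SO\<lparr>carrier := G\<rparr>) (top_of_set S) sphere_action)
     (top_of_set (proj ` S)) truncated_infdist"
proof -
  let ?GG = "SO\<lparr>carrier := G\<rparr>"
  let ?Q = "orbit_space ?GG (top_of_set S) sphere_action"
  have proj: "(truncated_infdist \<circ> orbit ?GG sphere_action) x = proj x" if "x \<in> S" for x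
  proof -
    have "orbit ?GG sphere_action x = (\<lambda>A. A *v x) ` G"
      using that by (auto simp: orbit_def sphere_action_def)
    then show ?thesis by (simp add: proj_def)
  qed
  have q: "quotient_map (top_of_set S) (top_of_set (proj ` S)) (truncated_infdist \<circ> orbit ?GG sphere_action)"
    using quotient_map_proj by (rule quotient_map_eq) (simp add: proj del: o_apply)
  have c: "continuous_map ?Q (top_of_set (proj ` S)) truncated_infdist"
    using quotient_map_orbit quotient_imp_continuous_map[OF q] by (rule continuous_compose_quotient_map)
  have "quotient_map ?Q (top_of_set (proj ` S)) truncated_infdist"
    by (rule quotient_map_from_composition[OF quotient_imp_continuous_map[OF quotient_map_orbit] c q])
  moreover have "inj_on truncated_infdist (topspace ?Q)"
  proof (rule inj_onI)
    fix a b assume ab: "a \<in> topspace ?Q" "b \<in> topspace ?Q" "truncated_infdist a = truncated_infdist b"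
    have "closed c \<and> c \<noteq> {}" if c: "c \<in> topspace ?Q" for c
    proof -
      obtain x where "x \<in> S" "c = orbit ?GG sphere_action x"
        using c by (auto simp: topspace_orbit_space orbits_def)
      then have "c = (\<lambda>A. A *v x) ` G" by (auto simp: orbit_def sphere_action_def)
      then show ?thesis using finite_G one_closed by (auto intro: finite_imp_closed)
    qed
    then show "a = b" using ab truncated_infdist_inject by blast
  qed
  ultimately show ?thesis by (simp add: homeomorphic_map_def)
qed

section \<open>Subgroups of the special orthogonal group\<close>

lemma inv_SO: 
  assumes "A \<in> carrier SO"
  shows "inv\<^bsub>SO\<^esub> A = transpose A"
  using assms by (intro group.inv_equality[OF group_SO])
    (auto simp: SO_def rotation_matrix_def orthogonal_matrix_def)

lemma subgroup_SO_iff: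
  assumes "finite N"
  shows "subgroup N SO \<longleftrightarrow> N \<subseteq> carrier SO \<and> finite_orthogonal_group N"
proof
  assume N: "subgroup N SO"
  have sub: "N \<subseteq> carrier SO" using N by (rule subgroup.subset)
  have "transpose A \<in> N" if "A \<in> N" for A
    using subgroup.m_inv_closed[OF N that] inv_SO sub that by force
  moreover have "orthogonal_matrix A" if "A \<in> N" for A
    using sub that by (auto simp: SO_def rotation_matrix_def)
  ultimately show "N \<subseteq> carrier SO \<and> finite_orthogonal_group N"
    using subgroup.one_closed[OF N] subgroup.m_closed[OF N] sub assms
    by (auto simp: finite_orthogonal_group_def SO_def)
next
  assume N: "N \<subseteq> carrier SO \<and> finite_orthogonal_group N"
  then interpret finite_orthogonal_group N by blast
  show "subgroup N SO"
  proof (rule group.subgroupI[OF group_SO])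
    show "inv\<^bsub>SO\<^esub> A \<in> N" if "A \<in> N" for A
      using N that transpose_closed by (auto simp: inv_SO)
  qed (use N one_closed mult_closed in \<open>auto simp: SO_def\<close>)
qed

text \<open>Armstrong's theorem for finite groups acting on spheres, as a criterion for simple connectedness.\<close>

theorem simply_connected_orbit_space_iff:
  fixes G :: "(real^'n^'n) set"
  assumes "subgroup G SO" "finite G" "3 \<le> CARD('n)"
  defines "GG \<equiv> SO\<lparr>carrier := G\<rparr>"
  defines "Q \<equiv> orbit_space GG (top_of_set (sphere 0 1)) sphere_action"
  shows "(\<forall>p\<in>topspace Q. trivial_group (fundamental_group Q p)) \<longleftrightarrow>
    generate GG {A \<in> G. \<exists>x\<in>sphere 0 1. A *v x = x} = G"
proof -
  interpret finite_orthogonal_group G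
    using subgroup_SO_iff[OF assms(2)] assms(1) by blast
  let ?F = "{A \<in> G. \<exists>x\<in>sphere 0 1. A *v x = x}"
  have GSO: "G \<subseteq> carrier SO" using assms(1) by (rule subgroup.subset)
  have gen: "generate GG ?F = generate SO ?F"
    unfolding GG_def using assms(1) by (intro group.generate_consistent[OF group_SO]) auto
  have sub: "subgroup (generate SO ?F) SO"
    using GSO by (intro group.generate_is_subgroup[OF group_SO]) auto
  have genG: "generate SO ?F \<subseteq> G"
    using assms(1) by (intro group.generate_subgroup_incl[OF group_SO]) auto
  have "path_connected (proj ` S)"
    using simply_connected_imp_path_connected[OF simply_connected_S[OF assms(3)]]
    by (intro path_connected_continuous_image continuous_on_proj)
  then have "(\<forall>p\<in>topspace Q. trivial_group (fundamental_group Q p)) \<longleftrightarrow> simply_connected (proj ` S)"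
    unfolding Q_def GG_def 
    by (rule trivial_fundamental_groups_iff_simply_connected[OF homeomorphic_orbit_space])
  also have "\<dots> \<longleftrightarrow> generate SO ?F = G"
  proof
    assume "simply_connected (proj ` S)"
    moreover have "finite_orthogonal_group (generate SO ?F)"
      using sub subgroup_SO_iff[OF finite_subset[OF genG assms(2)]] by blast
    ultimately show "generate SO ?F = G"
      using genG by (rule simply_connected_quotientD[OF assms(3)]) (rule generate.incl, blast)
  next
    assume eq: "generate SO ?F = G"
    show "simply_connected (proj ` S)"
    proof (rule simply_connected_quotientI[OF assms(3)])
      fix N assume N: "N \<subseteq> G" "finite_orthogonal_group N" "?F \<subseteq> N"
      then have "subgroup N SO"
        using subgroup_SO_iff[OF finite_subset[OF N(1) assms(2)]] GSO by blast
      then have "generate SO ?F \<subseteq> N"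
        using N by (intro group.generate_subgroup_incl[OF group_SO])
      then show "N = G" using N eq by blast
    qed
  qed
  finally show ?thesis by (simp only: gen)
qed

theorem proposition2p20:
  fixes G :: "(real^4^4) set"
  defines "GG \<equiv> SO\<lparr>carrier := G\<rparr>"
    and "S3 \<equiv> (sphere 0 1 :: (real^4) set)"
  defines "H \<equiv> normal_closure GG (\<Union>x\<in>S3. stabilizer GG sphere_action x)"
    and "Q \<equiv> orbit_space GG (top_of_set S3) sphere_action"
  assumes "subgroup G SO" and "discrete G"
  shows "(H = G \<longleftrightarrow> (\<forall>p\<in>topspace Q. trivial_group (fundamental_group Q p))) \<and>
    ((\<forall>p\<in>topspace Q. trivial_group (fundamental_group Q p)) \<longleftrightarrow>
       generate GG {A \<in> G. is_rotation A} = G)"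
proof -
  have GSO: "A \<in> carrier SO" "rotation_matrix A" "orthogonal_matrix A" if "A \<in> G" for A
    using subgroup.subset[OF assms(5)] that by (auto simp: SO_def rotation_matrix_def)
  have transp: "transpose A \<in> G" if "A \<in> G" for A
    using subgroup.m_inv_closed[OF assms(5) that] GSO[OF that] by (simp add: inv_SO)
  have mult: "A ** B \<in> G" if "A \<in> G" "B \<in> G" for A B
    using subgroup.m_closed[OF assms(5) that] by (simp add: SO_def)
  have "finite G"
    using assms(6) subgroup.one_closed[OF assms(5)] transp mult GSO
    by (intro finite_discrete_orthogonal_group) (auto simp: SO_def)
  then have main: "(\<forall>p\<in>topspace Q. trivial_group (fundamental_group Q p)) \<longleftrightarrow>
    generate GG {A \<in> G. \<exists>x\<in>sphere 0 1. A *v x = x} = G"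
    unfolding Q_def GG_def S3_def using assms(5) by (intro simply_connected_orbit_space_iff) auto
  let ?F = "{A \<in> G. \<exists>x\<in>sphere 0 1. A *v x = x}"
  have rot: "{A \<in> G. is_rotation A} = ?F"
    by (rule Collect_cong) (simp add: is_rotation_iff_fixed_point GSO(2) cong: conj_cong)
  have stab: "(\<Union>x\<in>S3. stabilizer GG sphere_action x) = ?F"
    by (auto simp: S3_def GG_def stabilizer_def sphere_action_def)
  have "group GG"
    unfolding GG_def using assms(5) by (rule group.subgroup_imp_group[OF group_SO])
  then have "normal_closure GG ?F = generate GG ?F"
  proof (rule group.normal_closure_eq_generate)
    show "?F \<subseteq> carrier GG" by (auto simp: GG_def)
    fix A B assume A: "A \<in> carrier GG" and B: "B \<in> ?F"
    then have AG: "A \<in> G" by (simp add: GG_def)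
    obtain x where x: "x \<in> sphere 0 1" "B *v x = x" "B \<in> G" using B by blast
    have "inv\<^bsub>GG\<^esub> A = transpose A"
      unfolding GG_def using group.m_inv_consistent[OF group_SO assms(5) AG] GSO[OF AG] by (simp add: inv_SO)
    then have eq: "A \<otimes>\<^bsub>GG\<^esub> B \<otimes>\<^bsub>GG\<^esub> inv\<^bsub>GG\<^esub> A = A ** B ** transpose A"
      by (simp add: GG_def SO_def)
    have "(A ** B ** transpose A) *v (A *v x) = A *v x"
      using x by (simp add: orthogonal_matrix_transpose_cancel[OF GSO(3)[OF AG]] flip: matrix_vector_mul_assoc)
    moreover have "A *v x \<in> sphere 0 1" 
      using x by (simp add: orthogonal_matrix_isometry[OF GSO(3)[OF AG]])
    moreover have "A ** B ** transpose A \<in> G"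
      using AG x(3) by (intro mult transp)
    ultimately show "A \<otimes>\<^bsub>GG\<^esub> B \<otimes>\<^bsub>GG\<^esub> inv\<^bsub>GG\<^esub> A \<in> ?F"
      unfolding eq by blast
  qed
  then have "H = generate GG ?F" by (simp add: H_def stab)
  then show ?thesis using main rot by auto
qed

end
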